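(* There exist an online algorithm and an absolute constant $C>0$ such that for every instance of online covering with $\ell_q$-norm objectives, every advice $x'\in\mathbb{R}^n_{\ge0}$ and every $\lambda\in(0,1)$, the final solution $\bar x$ is feasible ($A\bar x\ge\mathbf 1$) and $$f(\bar x)\le\min\Big\{\tfrac{C}{1-\lambda}f(x')+C\big(1+\log(\kappa d)\big)\mathsf{OPT},\ C\big(1+\log\tfrac{\kappa d}{\lambda}\big)\mathsf{OPT}\Big\}.$$ Moreover, if $Ax'\ge\mathbf 1$ then $f(\bar x)\le \frac{C}{1-\lambda}f(x')$.
   Context: Online covering with $\ell_q$-norm objectives: minimize $f(x)=\sum_{e=1}^r c_e\|x(S_e)\|_{q_e}$ over $x\in\mathbb{R}^n_{\ge0}$ subject to $Ax\ge\mathbf 1$, where $A=(a_{ij})\in\mathbb{R}^{m\times n}_{\ge0}$, each $S_e\subseteq[n]$, $q_e\ge1$, $c_e\ge0$, $x(S)$ is the restriction of $x$ to the coordinates in $S$, and $\|x(S)\|_q=(\sum_{i\in S}x_i^q)^{1/q}$. The sets $S_e$ need not be disjoint. $\kappa:=a_{\max}/a_{\min}$ with $a_{\max}$ and $a_{\min}$ the largest and smallest nonzero entries of $A$; $d:=\max\{\max_{i\in[m]}|\{j:a_{ij}>0\}|,\ \max_{e\in[r]}|S_e|\}$. Online model: $f$ (i.e. $r$, $c_e$, $S_e$, $q_e$), $n$, advice $x'$ and $\lambda$ are given in advance; the rows of $A$ arrive one at a time ($m$ unknown); after each arrival the algorithm must increase $x$ coordinatewise (never decrease) so that all revealed constraints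 hold, using only revealed information; $\bar x$ is the final vector. $\mathsf{OPT}=\min\{f(x): x\ge0, Ax\ge \mathbf 1\}$. *)

theory Defs
  imports Complex_Main
begin

text \<open>Vectors in R^n are functions nat => real, only coordinates j < n matter.
 A row of A is a function nat => real (entries a j for j < n).
 An objective term is a triple (c_e, S_e, q_e); the objective f is a list of such terms.\<close>

type_synonym vec = "nat \<Rightarrow> real"
type_synonym objective = "(real \<times> nat set \<times> real) list"

definition lqnorm :: "real \<Rightarrow> nat set \<Rightarrow> vec \<Rightarrow> real" where
  "lqnorm q S x = (\<Sum>i\<in>S. x i powr q) powr (1 / q)"

definition objf :: "objective \<Rightarrow> vec \<Rightarrow> real" where
  "objf F x = (\<Sum>(c, S, q)\<leftarrow>F. c * lqnorm q S x)"

definition valid_obj :: "nat \<Rightarrow> objective \<Rightarrow> bool" where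
  "valid_obj n F \<longleftrightarrow> (\<forall>(c, S, q)\<in>set F. c \<ge> 0 \<and> q \<ge> 1 \<and> S \<subseteq> {..<n})"

text \<open>A row is nonnegative and (so that the online instance is feasible) has a nonzero entry.\<close>
definition valid_row :: "nat \<Rightarrow> vec \<Rightarrow> bool" where
  "valid_row n a \<longleftrightarrow> (\<forall>j<n. a j \<ge> 0) \<and> (\<exists>j<n. a j > 0)"

definition valid_rows :: "nat \<Rightarrow> vec list \<Rightarrow> bool" where
  "valid_rows n As \<longleftrightarrow> (\<forall>a\<in>set As. valid_row n a)"

definition satisfies :: "nat \<Rightarrow> vec \<Rightarrow> vec \<Rightarrow> bool" where
  "satisfies n a x \<longleftrightarrow> (\<Sum>j<n. a j * x j) \<ge> 1"

definition feasible :: "nat \<Rightarrow> vec list \<Rightarrow> vec \<Rightarrow> bool" where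
  "feasible n As x \<longleftrightarrow> (\<forall>j<n. x j \<ge> 0) \<and> (\<forall>a\<in>set As. satisfies n a x)"

definition OPT :: "nat \<Rightarrow> objective \<Rightarrow> vec list \<Rightarrow> real" where
  "OPT n F As = Inf (objf F ` {x. feasible n As x})"

definition nz_entries :: "nat \<Rightarrow> vec list \<Rightarrow> real set" where
  "nz_entries n As = {a j |a j. a \<in> set As \<and> j < n \<and> a j > 0}"

definition kappa :: "nat \<Rightarrow> vec list \<Rightarrow> real" where
  "kappa n As = Max (nz_entries n As) / Min (nz_entries n As)"

definition dpar :: "nat \<Rightarrow> objective \<Rightarrow> vec list \<Rightarrow> nat" where
  "dpar n F As = max (Max (insert 0 ((\<lambda>a. card {j. j < n \<and> a j > 0}) ` set As)))
                     (Max (insert 0 ((\<lambda>(c, S, q). card S) ` set F)))"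

text \<open>An online algorithm: given n, the objective, the advice x' and lambda (known in advance)
 and the list of rows revealed so far, it outputs the current vector x.  Dependence only on the
 revealed prefix is built in; monotonicity and feasibility are required in the theorem.\<close>
type_synonym online_alg = "nat \<Rightarrow> objective \<Rightarrow> vec \<Rightarrow> real \<Rightarrow> vec list \<Rightarrow> vec"

end

theory Submission
  imports Defs "HOL-Analysis.Convex"
begin

text \<open>
  The main work is an online algorithm without advice whose cost is \<open>O(1 + ln (\<kappa> d)) OPT\<close>.
  While the arriving row \<open>b\<close> is violated, every \<open>x\<^sub>j + \<delta>\<close> is multiplied by
  \<open>1 + \<eta> b\<^sub>j / g\<^sub>j\<close>, where \<open>g\<close> is a perturbed gradient of the objective and \<open>\<eta>\<close> the increment of the
  dual variable of the row.  This costs \<open>O(\<eta>)\<close>, while for every feasible \<open>y\<close> it raises a potential by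
  at least \<open>\<eta>\<close>; the total increase of the potential is \<open>O(1 + ln (\<kappa> d)) f(y)\<close>.  The potential splits
  over the terms of the objective, so the sets may overlap.  Since \<open>\<kappa> d\<close> is not known in advance,
  it is guessed and the guess is squared whenever it turns out too small.

  Advice is followed by switching: take the unadvised solution while it is cheaper than \<open>x'\<close>,
  then \<open>x'\<close> while it is feasible, then the maximum of both.  The cost is then at most twice that of
  the unadvised solution, and at most \<open>2 f(x')\<close> if \<open>x'\<close> is feasible.
\<close>

section \<open>The \<open>q\<close>-norm\<close>

lemma lqnorm_cong: "(\<And>j. j \<in> S \<Longrightarrow> x j = y j) \<Longrightarrow> lqnorm q S x = lqnorm q S y"
  unfolding lqnorm_def by (metis (mono_tags, lifting) sum.cong)

lemma lqnorm_nonneg: "0 \<le> lqnorm q S x"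
  by (simp add: lqnorm_def)

lemma lqnorm_zero: "(\<And>j. j \<in> S \<Longrightarrow> x j = 0) \<Longrightarrow> lqnorm q S x = 0"
  by (simp add: lqnorm_def)

lemma lqnorm_mono:
  assumes "1 \<le> q" "\<And>j. j \<in> S \<Longrightarrow> 0 \<le> x j" "\<And>j. j \<in> S \<Longrightarrow> x j \<le> y j"
  shows "lqnorm q S x \<le> lqnorm q S y"
  unfolding lqnorm_def using assms
  by (intro powr_mono2 sum_mono sum_nonneg) auto

lemma lqnorm_scale:
  assumes "1 \<le> q" "0 \<le> k"
  shows "lqnorm q S (\<lambda>j. k * x j) = k * lqnorm q S x"
  using assms by (simp add: lqnorm_def powr_mult powr_powr flip: sum_distrib_left)

lemma lqnorm_powr:
  assumes "1 \<le> q"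
  shows "lqnorm q S x powr q = (\<Sum>j\<in>S. x j powr q)"
  using assms by (simp add: lqnorm_def powr_powr sum_nonneg)

lemma le_lqnorm:
  assumes "1 \<le> q" "finite S" "j \<in> S" "0 \<le> x j"
  shows "x j \<le> lqnorm q S x"
proof -
  have "x j powr q \<le> (\<Sum>j\<in>S. x j powr q)"
    using assms by (intro member_le_sum) auto
  then have "(x j powr q) powr (1/q) \<le> lqnorm q S x"
    unfolding lqnorm_def using assms by (intro powr_mono2) auto
  then show ?thesis using assms by (simp add: powr_powr)
qed

section \<open>Duality and the triangle inequality for the \<open>q\<close>-norm\<close>

lemma sum_normalized_powr:
  assumes "1 \<le> q" "lqnorm q S x \<noteq> 0"
  shows "(\<Sum>j\<in>S. (x j / lqnorm q S x) powr q) = 1"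
proof -
  have "(\<Sum>j\<in>S. (x j / lqnorm q S x) powr q) = (\<Sum>j\<in>S. x j powr q) / lqnorm q S x powr q"
    by (simp add: powr_divide sum_divide_distrib)
  also have "\<dots> = 1" using assms by (simp flip: lqnorm_powr)
  finally show ?thesis .
qed

lemma sum_powr_eq_lqnorm:
  assumes q: "1 \<le> q" and u: "\<And>j. j \<in> S \<Longrightarrow> 0 < u j" and U: "0 < lqnorm q S u"
  shows "(\<Sum>j\<in>S. (u j / lqnorm q S u) powr (q - 1) * u j) = lqnorm q S u"
proof -
  let ?U = "lqnorm q S u"
  have "(u j / ?U) powr (q - 1) * u j = ?U * (u j / ?U) powr q" if "j \<in> S" for j
    using u[OF that] U by (simp add: powr_diff)
  then have "(\<Sum>j\<in>S. (u j / ?U) powr (q - 1) * u j) = ?U * (\<Sum>j\<in>S. (u j / ?U) powr q)"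
    by (simp add: sum_distrib_left)
  then show ?thesis using sum_normalized_powr[of q S u] q U by simp
qed

lemma lqnorm_pos:
  assumes "1 \<le> q" "finite S" "S \<noteq> {}" "\<And>j. j \<in> S \<Longrightarrow> 0 < u j"
  shows "0 < lqnorm q S u"
  using assms le_lqnorm[of q S _ u] by (metis ex_in_conv less_le_trans order_less_imp_le)

lemma young_powr:
  fixes a b q :: real
  assumes "1 \<le> q" "0 < a" "0 \<le> b"
  shows "a powr (q - 1) * b \<le> (1 - 1/q) * a powr q + (1/q) * b powr q"
proof (cases "b = 0")
  case True
  then show ?thesis using assms by simp
next
  case False
  have "(a powr q) powr (1 - 1/q) * (b powr q) powr (1/q) \<le> (1 - 1/q) * a powr q + (1/q) * b powr q"
    using assms False by (intro Youngs_inequality_0) auto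
  moreover have "q * (1 - 1/q) = q - 1" using assms by (simp add: field_simps)
  ultimately show ?thesis using assms by (simp add: powr_powr)
qed

text \<open>Hoelder's inequality: the gradient of the norm at \<open>u\<close> has dual norm at most
  1. Both vectors are normalised and Young's inequality is applied coordinatewise; its weights
  \<open>1 - 1/q\<close> and \<open>1/q\<close> add up to 1.\<close>

lemma lqnorm_duality:
  assumes q: "1 \<le> q" and S: "finite S" and u: "\<And>j. j \<in> S \<Longrightarrow> 0 < u j" and v: "\<And>j. j \<in> S \<Longrightarrow> 0 \<le> v j"
  shows "(\<Sum>j\<in>S. (u j / lqnorm q S u) powr (q - 1) * v j) \<le> lqnorm q S v"
proof (cases "S = {} \<or> lqnorm q S v = 0")
  case True
  then have "v j = 0" if "j \<in> S" for j
    using that le_lqnorm[of q S j v] q S v[OF that] by auto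
  then show ?thesis by (simp add: lqnorm_nonneg)
next
  case False
  let ?U = "lqnorm q S u" and ?V = "lqnorm q S v"
  have U: "0 < ?U" using lqnorm_pos[OF q S _ u] False by auto
  have V: "0 < ?V" using False lqnorm_nonneg[of q S v] by auto
  have "(\<Sum>j\<in>S. (u j / ?U) powr (q - 1) * (v j / ?V))
      \<le> (\<Sum>j\<in>S. (1 - 1/q) * (u j / ?U) powr q + (1/q) * (v j / ?V) powr q)"
    using q u v U V by (intro sum_mono young_powr) auto
  also have "\<dots> = (1 - 1/q) * (\<Sum>j\<in>S. (u j / ?U) powr q) + (1/q) * (\<Sum>j\<in>S. (v j / ?V) powr q)"
    by (simp only: sum.distrib sum_distrib_left)
  also have "\<dots> = 1"
    using sum_normalized_powr[of q S u] sum_normalized_powr[of q S v] q U V by simp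
  finally show ?thesis using V by (simp add: field_simps flip: sum_divide_distrib)
qed

text \<open>The norm of \<open>u + v\<close> is the pairing of its own gradient with
  \<open>u + v\<close>, and this splits into two pairings bounded by
  \<open>lqnorm_duality\<close>.\<close>

lemma lqnorm_triangle:
  assumes q: "1 \<le> q" and S: "finite S" and u: "\<And>j. j \<in> S \<Longrightarrow> 0 \<le> u j" and v: "\<And>j. j \<in> S \<Longrightarrow> 0 \<le> v j"
  shows "lqnorm q S (\<lambda>j. u j + v j) \<le> lqnorm q S u + lqnorm q S v"
proof -
  \<comment> \<open>Duality asks for strictly positive coordinates, so the common zeros of
    \<open>u\<close> and \<open>v\<close> are removed first.\<close>
  define P where "P = {j\<in>S. 0 < u j + v j}"
  have P: "finite P" "P \<subseteq> S" using S by (auto simp: P_def)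
  have restr: "lqnorm q P w = lqnorm q S w" if "\<And>j. j \<in> S - P \<Longrightarrow> w j = 0" for w
    unfolding lqnorm_def using that P S by (subst sum.mono_neutral_left[of S P]) auto
  have zero: "u j = 0 \<and> v j = 0" if "j \<in> S - P" for j
    using that u[of j] v[of j] by (auto simp: P_def)
  let ?w = "\<lambda>j. u j + v j"
  have "lqnorm q P ?w \<le> lqnorm q P u + lqnorm q P v"
  proof (cases "P = {}")
    case False
    have w: "0 < ?w j" if "j \<in> P" for j using that by (simp add: P_def)
    have "lqnorm q P ?w = (\<Sum>j\<in>P. (?w j / lqnorm q P ?w) powr (q - 1) * ?w j)"
      using sum_powr_eq_lqnorm[OF q w lqnorm_pos[OF q P(1) False w]] by simp
    also have "\<dots> = (\<Sum>j\<in>P. (?w j / lqnorm q P ?w) powr (q - 1) * u j)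
        + (\<Sum>j\<in>P. (?w j / lqnorm q P ?w) powr (q - 1) * v j)"
      by (simp add: distrib_left sum.distrib)
    also have "\<dots> \<le> lqnorm q P u + lqnorm q P v"
      using P u v w by (intro add_mono lqnorm_duality[OF q P(1)]) auto
    finally show ?thesis .
  qed (simp add: lqnorm_def)
  moreover have "lqnorm q P ?w = lqnorm q S ?w" "lqnorm q P u = lqnorm q S u" "lqnorm q P v = lqnorm q S v"
    by (rule restr, use zero in simp)+
  ultimately show ?thesis by simp
qed

lemma lqnorm_le_sum:
  assumes "1 \<le> q" "finite S" "\<And>j. j \<in> S \<Longrightarrow> 0 \<le> u j"
  shows "lqnorm q S u \<le> (\<Sum>j\<in>S. u j)"
  using assms(2,3)
proof (induction S rule: finite_induct)
  case empty
  then show ?case by (simp add: lqnorm_def)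
next
  case (insert k S)
  let ?a = "\<lambda>j. if j = k then u k else 0" and ?b = "\<lambda>j. if j = k then 0 else u j"
  have "lqnorm q (insert k S) u = lqnorm q (insert k S) (\<lambda>j. ?a j + ?b j)"
    by (rule lqnorm_cong) auto
  also have "\<dots> \<le> lqnorm q (insert k S) ?a + lqnorm q (insert k S) ?b"
    using insert by (intro lqnorm_triangle[OF assms(1)]) auto
  also have "lqnorm q (insert k S) ?a = u k"
    using insert assms(1) by (simp add: lqnorm_def powr_powr if_distrib[of "\<lambda>z. z powr q"] sum.neutral)
  also have "lqnorm q (insert k S) ?b = lqnorm q S u"
  proof -
    have "(\<Sum>j\<in>S. ?b j powr q) = (\<Sum>j\<in>S. u j powr q)"
      using insert by (intro sum.cong) auto
    then show ?thesis using insert assms(1) by (simp add: lqnorm_def)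
  qed
  finally show ?case using insert by simp
qed

section \<open>Elementary bounds for logarithms and powers\<close>

lemma two_ln_ge:
  fixes t :: real
  assumes "0 \<le> t" "t \<le> 1"
  shows "t \<le> 2 * ln (1 + t)"
proof -
  have "t / (1 + t) \<le> ln (1 + t)"
    using ln_add_one_self_le_self2 ln_le_minus_one[of "1 / (1 + t)"] assms
    by (simp add: ln_div field_simps)
  moreover have "t / 2 \<le> t / (1 + t)" using assms by (intro divide_left_mono) auto
  ultimately show ?thesis by linarith
qed

text \<open>In one step a shifted coordinate grows by a factor of at most \<open>1 + 1/q\<close>;
  its power \<open>q - 1\<close> in the gradient then grows by at most \<open>exp 1\<close>,
  uniformly in \<open>q\<close>.\<close>

lemma one_plus_inverse_powr_le:
  fixes q :: real
  assumes "1 \<le> q"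
  shows "(1 + 1/q) powr (q - 1) \<le> 3"
proof -
  have "(1 + 1/q) powr (q - 1) \<le> (1 + 1/q) powr q" using assms by (intro powr_mono) auto
  also have "\<dots> = exp (q * ln (1 + 1/q))"
    using add_pos_pos[of 1 "1/q"] assms by (simp add: powr_def)
  also have "\<dots> \<le> exp 1"
  proof -
    have "q * ln (1 + 1/q) \<le> q * (1/q)"
      using assms ln_add_one_self_le_self[of "1/q"] by (intro mult_left_mono) auto
    then show ?thesis using assms by simp
  qed
  also have "\<dots> \<le> 3" by (rule exp_le)
  finally show ?thesis .
qed

section \<open>The potentials of a single term\<close>

text \<open>The gradient at a shifted point vanishes nowhere, but the shifted norm starts at a positive
  value that \<open>OPT\<close> need not cover.  The separable term \<open>bump\<close>, whose slope \<open>1 / (1 + M t)\<^sup>2\<close> matters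
  only for \<open>t\<close> of order \<open>1 / M\<close>, pays for the growth of the norm up to that value.\<close>

definition shifted :: "real \<Rightarrow> vec \<Rightarrow> vec" where
  "shifted M x = (\<lambda>j. x j + 1 / M\<^sup>2)"

definition bump :: "real \<Rightarrow> real \<Rightarrow> real" where
  "bump M t = t / (1 + M * t)"

text \<open>The gradient of \<open>primal_pot\<close>; the second summand is the derivative of
  \<open>bump M\<close>.\<close>

definition grad :: "real \<Rightarrow> real \<Rightarrow> nat set \<Rightarrow> vec \<Rightarrow> vec" where
  "grad M q S x = (\<lambda>j. (shifted M x j / lqnorm q S (shifted M x)) powr (q - 1) + 1 / (1 + M * x j)\<^sup>2)"

definition primal_pot :: "real \<Rightarrow> real \<Rightarrow> nat set \<Rightarrow> vec \<Rightarrow> real" where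
  "primal_pot M q S x = lqnorm q S (shifted M x) + (\<Sum>j\<in>S. bump M (x j))"

text \<open>The logarithms pay for the first summand of \<open>grad\<close>, the \<open>bump\<close>
  terms for the second. The weights \<open>(y j / lqnorm q S y) powr q\<close> sum to 1, or all
  vanish if \<open>y\<close> has norm 0.\<close>

definition dual_pot :: "real \<Rightarrow> real \<Rightarrow> nat set \<Rightarrow> vec \<Rightarrow> vec \<Rightarrow> real" where
  "dual_pot M q S y x =
     lqnorm q S y * (2 * ln (lqnorm q S (shifted M x))
       + 2 * (\<Sum>j\<in>S. (y j / lqnorm q S y) powr q * ln (1 + x j)))
     + 2 * (\<Sum>j\<in>S. bump M (x j) * y j)"

lemma bump_diff:
  assumes "0 < M" "0 \<le> s" "0 \<le> t"
  shows "bump M t - bump M s = (t - s) / ((1 + M * s) * (1 + M * t))"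
proof -
  have "1 + M * s > 0" "1 + M * t > 0" using assms by (auto intro: add_pos_nonneg)
  then show ?thesis by (simp add: bump_def divide_simps) (simp add: algebra_simps)
qed

lemma powr_minus_one_mult:
  fixes u q :: real
  assumes "0 < u"
  shows "u powr (q - 1) * u = u powr q"
  using assms by (simp add: powr_diff)

lemma powr_mult_le_sum_powr:
  fixes a b q :: real
  assumes "1 \<le> q" "0 < a" "0 \<le> b"
  shows "a powr (q - 1) * b \<le> a powr q + b powr q"
proof (cases "b \<le> a")
  case True
  then have "a powr (q - 1) * b \<le> a powr (q - 1) * a" by (intro mult_left_mono) auto
  then show ?thesis using assms by (simp add: powr_diff add_increasing2)
next
  case False
  then have "a powr (q - 1) * b \<le> b powr (q - 1) * b"
    using assms by (intro mult_right_mono powr_mono2) auto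
  then show ?thesis using assms False by (simp add: powr_diff add_increasing)
qed

section \<open>The range of the potentials of one term\<close>

locale norm_term =
  fixes M q :: real and S :: "nat set"
  assumes M: "1 \<le> M" and q: "1 \<le> q" and S: "finite S" "S \<noteq> {}" "real (card S) \<le> M"
begin

lemma shifted_pos: "0 \<le> x j \<Longrightarrow> 0 < shifted M x j"
  using M by (simp add: shifted_def add_nonneg_pos)

lemma shifted_norm_pos:
  assumes "\<And>j. j \<in> S \<Longrightarrow> 0 \<le> x j"
  shows "0 < lqnorm q S (shifted M x)"
  using assms shifted_pos by (intro lqnorm_pos q S) auto

lemma grad_pos: 
  assumes "0 \<le> x j"
  shows "0 < grad M q S x j"
proof -
  have "0 < 1 + M * x j" using assms M by (intro add_pos_nonneg) auto
  then show ?thesis unfolding grad_def by (intro add_nonneg_pos) auto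
qed

text \<open>At most \<open>M\<close> coordinates, each of size \<open>1 / M\<^sup>2\<close>. The
  shift is thus negligible against norms above \<open>2 / M\<close>, yet its logarithm is only of
  order \<open>ln M\<close>.\<close>

lemma shifted_norm_zero_le: "lqnorm q S (shifted M (\<lambda>_. 0)) \<le> 1 / M"
proof -
  have "lqnorm q S (shifted M (\<lambda>_. 0)) \<le> real (card S) * (1 / M\<^sup>2)"
    using lqnorm_le_sum[OF q S(1), of "shifted M (\<lambda>_. 0)"] M by (simp add: shifted_def)
  also have "\<dots> \<le> M * (1 / M\<^sup>2)" using S M by (intro mult_right_mono) auto
  finally show ?thesis using M by (simp add: power2_eq_square)
qed

lemma shifted_norm_zero_ge: "1 / M\<^sup>2 \<le> lqnorm q S (shifted M (\<lambda>_. 0))"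
proof -
  obtain j where "j \<in> S" using S by auto
  then show ?thesis using le_lqnorm[OF q S(1), of j "shifted M (\<lambda>_. 0)"] M by (simp add: shifted_def)
qed

text \<open>If the norm is at most \<open>2 / M\<close>, every \<open>M * x j\<close> is at most 2
  and \<open>bump\<close> alone recovers a third of each coordinate. Otherwise the shifted norm at
  zero is at most half the norm, so the growth of the shifted norm suffices.\<close>

lemma lqnorm_le_primal_pot:
  assumes x: "\<And>j. j \<in> S \<Longrightarrow> 0 \<le> x j"
  shows "lqnorm q S x \<le> 3 * (primal_pot M q S x - primal_pot M q S (\<lambda>_. 0))"
proof -
  let ?Z = "lqnorm q S (shifted M (\<lambda>_. 0))" and ?T = "lqnorm q S (shifted M x)"
  have diff: "primal_pot M q S x - primal_pot M q S (\<lambda>_. 0) = ?T - ?Z + (\<Sum>j\<in>S. bump M (x j))"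
    by (simp add: primal_pot_def bump_def)
  have bump: "0 \<le> bump M (x j)" if "j \<in> S" for j using x[OF that] M by (simp add: bump_def)
  have TZ: "?Z \<le> ?T" using x M by (intro lqnorm_mono q) (auto simp: shifted_def)
  have NT: "lqnorm q S x \<le> ?T" using x M by (intro lqnorm_mono q) (auto simp: shifted_def)
  show ?thesis
  proof (cases "lqnorm q S x \<le> 2 / M")
    case True
    have "x j \<le> 3 * bump M (x j)" if "j \<in> S" for j
    proof -
      have "x j \<le> 2 / M" using le_lqnorm[of q S j x] q S that x[OF that] True by simp
      then have "M * x j \<le> 2" using M by (simp add: field_simps)
      then have "x j * (1 + M * x j) \<le> x j * 3" using x[OF that] by (intro mult_left_mono) auto
      moreover have "0 < 1 + M * x j" using x[OF that] M by (intro add_pos_nonneg) auto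
      ultimately show ?thesis by (simp add: bump_def field_simps)
    qed
    then have "(\<Sum>j\<in>S. x j) \<le> (\<Sum>j\<in>S. 3 * bump M (x j))" by (rule sum_mono)
    also have "\<dots> = 3 * (\<Sum>j\<in>S. bump M (x j))" by (simp only: sum_distrib_left)
    finally have "(\<Sum>j\<in>S. x j) \<le> 3 * (\<Sum>j\<in>S. bump M (x j))" .
    moreover have "lqnorm q S x \<le> (\<Sum>j\<in>S. x j)" using x by (intro lqnorm_le_sum q S)
    moreover have "0 \<le> 3 * (?T - ?Z)" using TZ by simp
    ultimately show ?thesis unfolding diff distrib_left by linarith
  next
    case False
    have "2 / M = 2 * (1 / M)" by simp
    moreover have "0 \<le> (\<Sum>j\<in>S. bump M (x j))" using bump by (rule sum_nonneg)
    moreover have "0 \<le> lqnorm q S x" by (rule lqnorm_nonneg)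
    moreover have "2 / M < lqnorm q S x" using False by simp
    ultimately show ?thesis unfolding diff using shifted_norm_zero_le NT by argo
  qed
qed

text \<open>The cap \<open>3 * M\<close> and the shift \<open>1 / M\<^sup>2\<close> confine each
  logarithm to a range of order \<open>1 + ln M\<close>, and the weights sum to at most 1. Each
  \<open>bump\<close> is at most \<open>1 / M\<close>, and there are at most \<open>M\<close> of
  them.\<close>

lemma dual_pot_diff_le:
  assumes x: "\<And>j. j \<in> S \<Longrightarrow> 0 \<le> x j \<and> x j \<le> 3 * M" and y: "\<And>j. j \<in> S \<Longrightarrow> 0 \<le> y j"
  shows "dual_pot M q S y x - dual_pot M q S y (\<lambda>_. 0) \<le> (10 + 10 * ln M) * lqnorm q S y"
proof -
  let ?Z = "lqnorm q S (shifted M (\<lambda>_. 0))" and ?T = "lqnorm q S (shifted M x)" and ?Y = "lqnorm q S y"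
  have ln4: "ln (4::real) \<le> 2"
  proof -
    have "(4::real) = 2 * 2" by simp
    then have "ln (4::real) = ln 2 + ln 2" by (metis ln_mult_pos zero_less_numeral)
    then show ?thesis using ln_le_minus_one[of "2::real"] by simp
  qed
  have "?T \<le> (\<Sum>j\<in>S. shifted M x j)"
    using x shifted_pos by (intro lqnorm_le_sum q S) (simp add: less_imp_le)
  also have "\<dots> \<le> real (card S) * (4 * M)"
  proof (rule sum_bounded_above)
    fix j assume "j \<in> S"
    moreover have "1 / M\<^sup>2 \<le> 1" using M by simp
    ultimately show "shifted M x j \<le> 4 * M" using x[of j] M unfolding shifted_def by linarith
  qed
  also have "\<dots> \<le> M * (4 * M)" using S M by (intro mult_right_mono) auto
  finally have "?T \<le> 4 * M\<^sup>2" by (simp add: power2_eq_square)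
  moreover have "0 < ?T" using x by (intro shifted_norm_pos) auto
  ultimately have "ln ?T \<le> ln (4 * M\<^sup>2)" using M by simp
  also have "\<dots> = ln 4 + 2 * ln M" using M by (simp add: ln_mult ln_realpow)
  finally have lnT: "ln ?T \<le> ln 4 + 2 * ln M" .
  have "ln (1 / M\<^sup>2) \<le> ln ?Z" using shifted_norm_zero_ge M by (intro ln_mono) auto
  then have lnZ: "- 2 * ln M \<le> ln ?Z" using M by (simp add: ln_div ln_realpow)
  have lnx: "ln (1 + x j) \<le> ln 4 + ln M" if "j \<in> S" for j
  proof -
    have "ln (1 + x j) \<le> ln (4 * M)" using x[OF that] M by (intro ln_mono) auto
    then show ?thesis using M by (simp add: ln_mult)
  qed
  have "(\<Sum>j\<in>S. (y j / ?Y) powr q * ln (1 + x j)) \<le> (\<Sum>j\<in>S. (y j / ?Y) powr q * (ln 4 + ln M))"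
    using lnx by (intro sum_mono mult_left_mono) auto
  also have "\<dots> = (\<Sum>j\<in>S. (y j / ?Y) powr q) * (ln 4 + ln M)" by (simp only: sum_distrib_right)
  also have "\<dots> \<le> 1 * (ln 4 + ln M)"
    using sum_normalized_powr[OF q, of S y] M by (intro mult_right_mono) (cases "?Y = 0"; simp)+
  finally have W: "(\<Sum>j\<in>S. (y j / ?Y) powr q * ln (1 + x j)) \<le> ln 4 + ln M" by simp
  have "(\<Sum>j\<in>S. bump M (x j) * y j) \<le> real (card S) * (1 / M * ?Y)"
  proof (rule sum_bounded_above)
    fix j assume j: "j \<in> S"
    have "0 < 1 + M * x j" using x[OF j] M by (intro add_pos_nonneg) auto
    then have "bump M (x j) \<le> 1 / M" using M by (simp add: bump_def field_simps)
    then show "bump M (x j) * y j \<le> 1 / M * ?Y"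
      using j x[OF j] y[OF j] M le_lqnorm[of q S j y] q S by (intro mult_mono) (auto simp: bump_def)
  qed
  also have "\<dots> \<le> M * (1 / M * ?Y)"
    using S M by (intro mult_right_mono) (auto simp: lqnorm_nonneg)
  finally have B: "(\<Sum>j\<in>S. bump M (x j) * y j) \<le> ?Y" using M by simp
  \<comment> \<open>Twice the bounds \<open>lnT\<close>, \<open>lnZ\<close> and \<open>W\<close> add
    up to \<open>4 * ln 4 + 10 * ln M\<close>, and \<open>ln 4 \<le> 2\<close>.\<close>
  have "?Y * (2 * ln ?T + 2 * (\<Sum>j\<in>S. (y j / ?Y) powr q * ln (1 + x j)) - 2 * ln ?Z)
      \<le> ?Y * (8 + 10 * ln M)"
    using lnT lnZ W ln4 by (intro mult_left_mono) (auto simp: lqnorm_nonneg)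
  then have "?Y * (2 * ln ?T + 2 * (\<Sum>j\<in>S. (y j / ?Y) powr q * ln (1 + x j))) - ?Y * (2 * ln ?Z)
      \<le> ?Y * (8 + 10 * ln M)"
    by (simp only: right_diff_distrib)
  moreover have "dual_pot M q S y (\<lambda>_. 0) = ?Y * (2 * ln ?Z)"
    by (simp add: dual_pot_def bump_def)
  moreover have "dual_pot M q S y x =
     ?Y * (2 * ln ?T + 2 * (\<Sum>j\<in>S. (y j / ?Y) powr q * ln (1 + x j))) + 2 * (\<Sum>j\<in>S. bump M (x j) * y j)"
    by (simp add: dual_pot_def)
  moreover have "?Y * (8 + 10 * ln M) + 2 * ?Y = (10 + 10 * ln M) * ?Y" by (simp add: algebra_simps)
  ultimately show ?thesis using B by linarith
qed

section \<open>The effect of one multiplicative step on one term\<close>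

context
  fixes \<tau> :: real and \<theta> x x' :: vec
  assumes tau: "\<tau> * (M\<^sup>2 * q) \<le> 1"
    and x: "\<And>j. j \<in> S \<Longrightarrow> 0 \<le> x j"
    and theta: "\<And>j. j \<in> S \<Longrightarrow> 0 \<le> \<theta> j \<and> \<theta> j \<le> \<tau>"
    and x': "\<And>j. j \<in> S \<Longrightarrow> x' j = x j + \<theta> j * (x j + 1)"
begin

lemma step_mono: "j \<in> S \<Longrightarrow> x j \<le> x' j"
  using x theta x' by simp

lemma theta_bounds:
  assumes "j \<in> S"
  shows "\<theta> j * (M\<^sup>2 * q) \<le> 1" "\<theta> j * M \<le> 1" "\<theta> j \<le> 1"
proof -
  have M2: "1 \<le> M\<^sup>2" using M by simp
  have MM: "M \<le> M\<^sup>2" using M by (simp add: power2_eq_square)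
  have "M\<^sup>2 * 1 \<le> M\<^sup>2 * q" using q by (intro mult_left_mono) auto
  then have Mq: "M \<le> M\<^sup>2 * q" "1 \<le> M\<^sup>2 * q" using M2 MM by linarith+
  have "\<theta> j * (M\<^sup>2 * q) \<le> \<tau> * (M\<^sup>2 * q)" using theta[OF assms] Mq by (intro mult_right_mono) auto
  then show 1: "\<theta> j * (M\<^sup>2 * q) \<le> 1" using tau by simp
  have "\<theta> j * M \<le> \<theta> j * (M\<^sup>2 * q)" "\<theta> j * 1 \<le> \<theta> j * (M\<^sup>2 * q)"
    using theta[OF assms] Mq by (intro mult_left_mono; simp)+
  then show "\<theta> j * M \<le> 1" "\<theta> j \<le> 1" using 1 by linarith+
qed

text \<open>Since \<open>x j + 1 \<le> M\<^sup>2 * shifted M x j\<close>, the step adds at most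
  \<open>\<theta> j * M\<^sup>2\<close> times the shifted coordinate, and the bound on
  \<open>\<tau>\<close> makes this factor at most \<open>1 / q\<close>.\<close>

lemma step_shifted_le:
  assumes "j \<in> S"
  shows "shifted M x' j \<le> (1 + 1/q) * shifted M x j"
proof -
  have "x j + 1 \<le> M\<^sup>2 * shifted M x j"
  proof -
    have "1 * x j \<le> M\<^sup>2 * x j" using x[OF assms] M by (intro mult_right_mono) auto
    then show ?thesis using M by (simp add: shifted_def distrib_left)
  qed
  then have "\<theta> j * (x j + 1) \<le> \<theta> j * (M\<^sup>2 * shifted M x j)"
    using theta[OF assms] by (intro mult_left_mono) auto
  also have "\<dots> = (\<theta> j * (M\<^sup>2 * q)) * (shifted M x j / q)" using q by simp
  also have "\<dots> \<le> 1 * (shifted M x j / q)"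
    using theta_bounds[OF assms] shifted_pos[of x j] x[OF assms] q by (intro mult_right_mono) auto
  finally have "\<theta> j * (x j + 1) \<le> shifted M x j / q" by simp
  moreover have "shifted M x' j = shifted M x j + \<theta> j * (x j + 1)"
    using x'[OF assms] by (simp add: shifted_def)
  ultimately show ?thesis by (simp add: distrib_right)
qed

lemma step_norm_bounds:
  "lqnorm q S (shifted M x) \<le> lqnorm q S (shifted M x')"
  "lqnorm q S (shifted M x') \<le> 2 * lqnorm q S (shifted M x)"
proof -
  show "lqnorm q S (shifted M x) \<le> lqnorm q S (shifted M x')"
    using x step_mono M by (intro lqnorm_mono q) (auto simp: shifted_def)
  have "shifted M x' j \<le> 2 * shifted M x j" if "j \<in> S" for j
  proof -
    have "(1 + 1/q) * shifted M x j \<le> 2 * shifted M x j"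
      using q shifted_pos[of x j] x[OF that] by (intro mult_right_mono) auto
    then show ?thesis using step_shifted_le[OF that] by linarith
  qed
  moreover have "0 \<le> shifted M x' j" if "j \<in> S" for j
    using shifted_pos[of x' j] x[OF that] step_mono[OF that] by simp
  ultimately have "lqnorm q S (shifted M x') \<le> lqnorm q S (\<lambda>j. 2 * shifted M x j)"
    by (intro lqnorm_mono q)
  then show "lqnorm q S (shifted M x') \<le> 2 * lqnorm q S (shifted M x)"
    using lqnorm_scale[OF q, of 2 S "shifted M x"] by simp
qed

text \<open>The difference quotient of \<open>bump\<close> is the reciprocal of
  \<open>(1 + M * x j) * (1 + M * x' j)\<close>, and \<open>1 + M * x j\<close> at most doubles in a
  step. So the slope at the old point is correct up to a factor 2.\<close>

lemma step_bump:
  assumes "j \<in> S"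
  shows "bump M (x' j) - bump M (x j) \<le> (x' j - x j) / (1 + M * x j)\<^sup>2"
    and "(x' j - x j) / (1 + M * x j)\<^sup>2 \<le> 2 * (bump M (x' j) - bump M (x j))"
proof -
  let ?a = "1 + M * x j" and ?b = "1 + M * x' j"
  have a: "0 < ?a" using x[OF assms] M by (intro add_pos_nonneg) auto
  have le: "?a \<le> ?b" using step_mono[OF assms] M by simp
  have "M * x' j = M * x j + (\<theta> j * M) * (x j + 1)" using x'[OF assms] by (simp add: algebra_simps)
  also have "\<dots> \<le> M * x j + 1 * (x j + 1)"
    using theta_bounds[OF assms] x[OF assms] by (intro add_left_mono mult_right_mono) auto
  also have "\<dots> \<le> M * x j + (M * x j + 1)"
  proof -
    have "1 * x j \<le> M * x j" using M x[OF assms] by (intro mult_right_mono) auto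
    then show ?thesis by simp
  qed
  finally have b: "?b \<le> 2 * ?a" by simp
  have d: "bump M (x' j) - bump M (x j) = (x' j - x j) / (?a * ?b)"
    using bump_diff[of M "x j" "x' j"] x[OF assms] step_mono[OF assms] M by simp
  have "?a * ?a \<le> ?a * ?b" using a le by (intro mult_left_mono) auto
  then show "bump M (x' j) - bump M (x j) \<le> (x' j - x j) / ?a\<^sup>2"
    unfolding d power2_eq_square using step_mono[OF assms] a le by (intro divide_left_mono) auto
  have "?a * ?b \<le> 2 * ?a\<^sup>2" using mult_left_mono[OF b, of ?a] a by (simp add: power2_eq_square)
  then have "(x' j - x j) / (2 * ?a\<^sup>2) \<le> (x' j - x j) / (?a * ?b)"
    using step_mono[OF assms] a le by (intro divide_left_mono) auto
  moreover have "(x' j - x j) / (2 * ?a\<^sup>2) = (x' j - x j) / ?a\<^sup>2 / 2" by simp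
  ultimately show "(x' j - x j) / ?a\<^sup>2 \<le> 2 * (bump M (x' j) - bump M (x j))"
    unfolding d by linarith
qed

text \<open>By convexity the norm grows by at most the pairing of the gradient at the new point with
  the step; going back to the gradient at the old point costs the factor 3.\<close>

lemma primal_step:
  "primal_pot M q S x' - primal_pot M q S x \<le> 3 * (\<Sum>j\<in>S. grad M q S x j * (x' j - x j))"
proof -
  let ?T = "lqnorm q S (shifted M x)" and ?T' = "lqnorm q S (shifted M x')"
  have T: "0 < ?T" using x by (rule shifted_norm_pos)
  have T': "0 < ?T'" using T step_norm_bounds by linarith
  have sx: "0 < shifted M x j" "0 < shifted M x' j" if "j \<in> S" for j
    using shifted_pos[of x j] shifted_pos[of x' j] x[OF that] step_mono[OF that] by auto
  have "?T' = (\<Sum>j\<in>S. (shifted M x' j / ?T') powr (q - 1) * shifted M x' j)"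
    using sum_powr_eq_lqnorm[OF q sx(2) T'] by simp
  moreover have "(\<Sum>j\<in>S. (shifted M x' j / ?T') powr (q - 1) * shifted M x j) \<le> ?T"
    using sx by (intro lqnorm_duality q S) (auto intro: less_imp_le)
  ultimately have "?T' - ?T \<le> (\<Sum>j\<in>S. (shifted M x' j / ?T') powr (q - 1) * shifted M x' j)
      - (\<Sum>j\<in>S. (shifted M x' j / ?T') powr (q - 1) * shifted M x j)" by linarith
  also have "\<dots> = (\<Sum>j\<in>S. (shifted M x' j / ?T') powr (q - 1) * (x' j - x j))"
    by (simp add: shifted_def algebra_simps flip: sum_subtractf)
  also have "\<dots> \<le> (\<Sum>j\<in>S. 3 * ((shifted M x j / ?T) powr (q - 1) * (x' j - x j)))"
  proof (rule sum_mono)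
    fix j assume j: "j \<in> S"
    have "shifted M x' j / ?T' \<le> (1 + 1/q) * shifted M x j / ?T"
      using step_shifted_le[OF j] step_norm_bounds(1) T sx[OF j] by (intro frac_le) auto
    then have "(shifted M x' j / ?T') powr (q - 1) \<le> ((1 + 1/q) * (shifted M x j / ?T)) powr (q - 1)"
      using q sx[OF j] T' by (intro powr_mono2) auto
    also have "\<dots> = (1 + 1/q) powr (q - 1) * (shifted M x j / ?T) powr (q - 1)" by (rule powr_mult)
    also have "\<dots> \<le> 3 * (shifted M x j / ?T) powr (q - 1)"
      using one_plus_inverse_powr_le[OF q] by (intro mult_right_mono) auto
    finally have "(shifted M x' j / ?T') powr (q - 1) * (x' j - x j)
        \<le> 3 * (shifted M x j / ?T) powr (q - 1) * (x' j - x j)"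
      using step_mono[OF j] by (intro mult_right_mono) auto
    then show "(shifted M x' j / ?T') powr (q - 1) * (x' j - x j)
        \<le> 3 * ((shifted M x j / ?T) powr (q - 1) * (x' j - x j))" by simp
  qed
  finally have A: "?T' - ?T \<le> 3 * (\<Sum>j\<in>S. (shifted M x j / ?T) powr (q - 1) * (x' j - x j))"
    by (simp only: sum_distrib_left)
  have "(\<Sum>j\<in>S. bump M (x' j)) - (\<Sum>j\<in>S. bump M (x j)) \<le> (\<Sum>j\<in>S. (x' j - x j) / (1 + M * x j)\<^sup>2)"
    unfolding sum_subtractf[symmetric] using step_bump(1) by (rule sum_mono)
  moreover have "0 \<le> (\<Sum>j\<in>S. (x' j - x j) / (1 + M * x j)\<^sup>2)"
    using step_mono by (intro sum_nonneg) auto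
  moreover have "(\<Sum>j\<in>S. grad M q S x j * (x' j - x j)) =
      (\<Sum>j\<in>S. (shifted M x j / ?T) powr (q - 1) * (x' j - x j)) + (\<Sum>j\<in>S. (x' j - x j) / (1 + M * x j)\<^sup>2)"
    by (simp add: grad_def distrib_right sum.distrib)
  ultimately show ?thesis using A by (simp add: primal_pot_def)
qed

text \<open>Instead of integrating the dual solution and bounding its dual norm, the bound
  \<open>a\<^bsup>q-1\<^esup> b \<le> a\<^bsup>q\<^esup> + b\<^bsup>q\<^esup>\<close> is applied to every increment: the first part telescopes to the logarithm of
  the norm, the second to logarithms of the coordinates.\<close>

lemma dual_step:
  assumes y: "\<And>j. j \<in> S \<Longrightarrow> 0 \<le> y j"
  shows "(\<Sum>j\<in>S. grad M q S x j * \<theta> j * y j) \<le> dual_pot M q S y x' - dual_pot M q S y x"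
proof -
  let ?T = "lqnorm q S (shifted M x)" and ?T' = "lqnorm q S (shifted M x')" and ?Y = "lqnorm q S y"
  let ?D = "\<lambda>j. x' j - x j"
  have T: "0 < ?T" using x by (rule shifted_norm_pos)
  have sx: "0 < shifted M x j" "0 < shifted M x' j" if "j \<in> S" for j
    using shifted_pos[of x j] shifted_pos[of x' j] x[OF that] step_mono[OF that] by auto
  have D: "\<theta> j \<le> ?D j" "\<theta> j * shifted M x j \<le> ?D j" if "j \<in> S" for j
  proof -
    have "\<theta> j * 1 \<le> \<theta> j * (x j + 1)" "\<theta> j * shifted M x j \<le> \<theta> j * (x j + 1)"
      using theta[OF that] x[OF that] M by (intro mult_left_mono; simp add: shifted_def)+
    then show "\<theta> j \<le> ?D j" "\<theta> j * shifted M x j \<le> ?D j" using x'[OF that] by auto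
  qed
  have first: "(shifted M x j / ?T) powr (q - 1) * \<theta> j * y j \<le>
      ?Y * ((shifted M x j / ?T) powr (q - 1) * ?D j / ?T
            + (y j / ?Y) powr q * (2 * (ln (1 + x' j) - ln (1 + x j))))" if j: "j \<in> S" for j
  proof (cases "?Y = 0")
    case True
    then have "y j = 0" using le_lqnorm[of q S j y] q S j y[OF j] by auto
    then show ?thesis using True by simp
  next
    case False
    then have Y: "0 < ?Y" using lqnorm_nonneg[of q S y] by linarith
    let ?u = "shifted M x j / ?T"
    have u: "0 < ?u" using sx[OF j] T by simp
    have "?u powr (q - 1) * \<theta> j * y j = ?Y * \<theta> j * (?u powr (q - 1) * (y j / ?Y))" using Y by simp
    also have "\<dots> \<le> ?Y * \<theta> j * (?u powr q + (y j / ?Y) powr q)"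
      using u Y y[OF j] theta[OF j] by (intro mult_left_mono powr_mult_le_sum_powr q) auto
    also have "\<dots> = ?Y * (\<theta> j * ?u powr q + (y j / ?Y) powr q * \<theta> j)" by (simp add: algebra_simps)
    also have "\<dots> \<le> ?Y * (?u powr (q - 1) * ?D j / ?T
            + (y j / ?Y) powr q * (2 * (ln (1 + x' j) - ln (1 + x j))))"
    proof (intro mult_left_mono add_mono)
      have "?u powr q = ?u powr (q - 1) * ?u" by (rule powr_minus_one_mult[OF u, symmetric])
      then have "\<theta> j * ?u powr q = ?u powr (q - 1) * (\<theta> j * shifted M x j) / ?T" by simp
      also have "\<dots> \<le> ?u powr (q - 1) * ?D j / ?T"
        using D(2)[OF j] T by (intro divide_right_mono mult_left_mono) auto
      finally show "\<theta> j * ?u powr q \<le> ?u powr (q - 1) * ?D j / ?T" .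
      \<comment> \<open>The step multiplies \<open>1 + x j\<close> by exactly
        \<open>1 + \<theta> j\<close>, so the logarithm rises by at least half of
        \<open>\<theta> j\<close>.\<close>
      have "1 + x' j = (1 + \<theta> j) * (1 + x j)" using x'[OF j] by (simp add: algebra_simps)
      then have "ln (1 + x' j) = ln (1 + \<theta> j) + ln (1 + x j)"
        using theta[OF j] x[OF j] by (simp add: ln_mult)
      then show "\<theta> j \<le> 2 * (ln (1 + x' j) - ln (1 + x j))"
        using two_ln_ge[of "\<theta> j"] theta[OF j] theta_bounds[OF j] by simp
    qed (use Y in auto)
    finally show ?thesis .
  qed
  have second: "1 / (1 + M * x j)\<^sup>2 * \<theta> j * y j \<le> 2 * (bump M (x' j) - bump M (x j)) * y j" if j: "j \<in> S" for j
  proof (rule mult_right_mono)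
    have "1 / (1 + M * x j)\<^sup>2 * \<theta> j \<le> ?D j / (1 + M * x j)\<^sup>2"
      using D(1)[OF j] by (simp add: divide_right_mono)
    then show "1 / (1 + M * x j)\<^sup>2 * \<theta> j \<le> 2 * (bump M (x' j) - bump M (x j))"
      using step_bump(2)[OF j] by linarith
  qed (rule y[OF j])
  \<comment> \<open>Convexity at the old point bounds the pairing by the growth of the norm. As the
    norm at most doubles, its relative growth is at most 1 and \<open>two_ln_ge\<close>
    applies.\<close>
  have lnT: "(\<Sum>j\<in>S. (shifted M x j / ?T) powr (q - 1) * ?D j / ?T) \<le> 2 * (ln ?T' - ln ?T)"
  proof -
    have "?T = (\<Sum>j\<in>S. (shifted M x j / ?T) powr (q - 1) * shifted M x j)"
      using sum_powr_eq_lqnorm[OF q sx(1) T] by simp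
    moreover have "(\<Sum>j\<in>S. (shifted M x j / ?T) powr (q - 1) * shifted M x' j) \<le> ?T'"
      using sx by (intro lqnorm_duality q S) (auto intro: less_imp_le)
    moreover have "(\<Sum>j\<in>S. (shifted M x j / ?T) powr (q - 1) * ?D j) =
        (\<Sum>j\<in>S. (shifted M x j / ?T) powr (q - 1) * shifted M x' j)
        - (\<Sum>j\<in>S. (shifted M x j / ?T) powr (q - 1) * shifted M x j)"
      by (simp add: shifted_def algebra_simps flip: sum_subtractf)
    ultimately have "(\<Sum>j\<in>S. (shifted M x j / ?T) powr (q - 1) * ?D j) \<le> ?T' - ?T" by linarith
    then have "(\<Sum>j\<in>S. (shifted M x j / ?T) powr (q - 1) * ?D j) / ?T \<le> (?T' - ?T) / ?T"
      using T by (intro divide_right_mono) auto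
    also have "\<dots> \<le> 2 * ln (1 + (?T' - ?T) / ?T)"
      using step_norm_bounds T by (intro two_ln_ge) (auto simp: field_simps)
    also have "1 + (?T' - ?T) / ?T = ?T' / ?T" using T by (simp add: field_simps)
    also have "ln (?T' / ?T) = ln ?T' - ln ?T" using T step_norm_bounds by (simp add: ln_div)
    finally show ?thesis by (simp add: sum_divide_distrib)
  qed
  have "(\<Sum>j\<in>S. grad M q S x j * \<theta> j * y j) =
      (\<Sum>j\<in>S. (shifted M x j / ?T) powr (q - 1) * \<theta> j * y j) + (\<Sum>j\<in>S. 1 / (1 + M * x j)\<^sup>2 * \<theta> j * y j)"
    by (simp add: grad_def distrib_right sum.distrib)
  also have "\<dots> \<le> (\<Sum>j\<in>S. ?Y * ((shifted M x j / ?T) powr (q - 1) * ?D j / ?T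
            + (y j / ?Y) powr q * (2 * (ln (1 + x' j) - ln (1 + x j)))))
      + (\<Sum>j\<in>S. 2 * (bump M (x' j) - bump M (x j)) * y j)"
    using first second by (intro add_mono sum_mono)
  also have "\<dots> = ?Y * ((\<Sum>j\<in>S. (shifted M x j / ?T) powr (q - 1) * ?D j / ?T)
            + (\<Sum>j\<in>S. (y j / ?Y) powr q * (2 * (ln (1 + x' j) - ln (1 + x j)))))
      + (\<Sum>j\<in>S. 2 * (bump M (x' j) - bump M (x j)) * y j)"
    by (simp only: sum_distrib_left[symmetric] sum.distrib)
  also have "\<dots> \<le> ?Y * (2 * (ln ?T' - ln ?T)
            + (\<Sum>j\<in>S. (y j / ?Y) powr q * (2 * (ln (1 + x' j) - ln (1 + x j)))))
      + (\<Sum>j\<in>S. 2 * (bump M (x' j) - bump M (x j)) * y j)"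
    using lnT lqnorm_nonneg[of q S y] by (intro add_right_mono mult_left_mono) auto
  also have "(\<Sum>j\<in>S. (y j / ?Y) powr q * (2 * (ln (1 + x' j) - ln (1 + x j))))
      = 2 * (\<Sum>j\<in>S. (y j / ?Y) powr q * ln (1 + x' j)) - 2 * (\<Sum>j\<in>S. (y j / ?Y) powr q * ln (1 + x j))"
    by (simp only: sum_distrib_left sum_subtractf[symmetric], intro sum.cong refl, simp only: algebra_simps)
  also have "(\<Sum>j\<in>S. 2 * (bump M (x' j) - bump M (x j)) * y j)
      = 2 * (\<Sum>j\<in>S. bump M (x' j) * y j) - 2 * (\<Sum>j\<in>S. bump M (x j) * y j)"
    by (simp only: sum_distrib_left sum_subtractf[symmetric], intro sum.cong refl, simp only: algebra_simps)
  finally show ?thesis by (simp add: dual_pot_def algebra_simps)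
qed

end

end

section \<open>Covering with a known scale\<close>

lemma primal_pot_cong: "(\<And>j. j \<in> S \<Longrightarrow> x j = x' j) \<Longrightarrow> primal_pot M q S x = primal_pot M q S x'"
  unfolding primal_pot_def using lqnorm_cong[of S "shifted M x" "shifted M x'" q]
  by (simp add: shifted_def)

lemma dual_pot_cong: "(\<And>j. j \<in> S \<Longrightarrow> x j = x' j) \<Longrightarrow> dual_pot M q S y x = dual_pot M q S y x'"
  unfolding dual_pot_def using lqnorm_cong[of S "shifted M x" "shifted M x'" q]
  by (simp add: shifted_def)

lemma satisfies_mono:
  assumes "valid_row n b" "satisfies n b x" "\<And>j. j < n \<Longrightarrow> x j \<le> x' j"
  shows "satisfies n b x'"
proof -
  have "(\<Sum>j<n. b j * x j) \<le> (\<Sum>j<n. b j * x' j)"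
    using assms by (intro sum_mono mult_left_mono) (auto simp: valid_row_def)
  then show ?thesis using assms(2) by (simp add: satisfies_def)
qed

text \<open>Free of assumptions, so that the algorithm is a total function of its data; the
  hypotheses of the analysis enter in \<open>norm_covering\<close>.\<close>

locale norm_cover =
  fixes E :: "nat set" and c :: "nat \<Rightarrow> real" and S :: "nat \<Rightarrow> nat set" and q :: "nat \<Rightarrow> real"
    and n :: nat and M :: real
begin

definition total_grad :: "vec \<Rightarrow> vec" where
  "total_grad x j = (\<Sum>e | e \<in> E \<and> j \<in> S e. c e * grad M (q e) (S e) x j)"

text \<open>Small enough for the step bound of every term at once; the summand 1 keeps the
  denominator positive even without terms.\<close>

definition tau :: real where
  "tau = 1 / (M\<^sup>2 * (1 + (\<Sum>e\<in>E. q e)))"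

definition free :: "nat \<Rightarrow> bool" where
  "free j \<longleftrightarrow> (\<forall>e\<in>E. j \<notin> S e)"

text \<open>The dual increment: the largest value for which no coordinate of the row gets an
  \<open>incr\<close> above \<open>tau\<close>.\<close>

definition rate :: "vec \<Rightarrow> vec \<Rightarrow> real" where
  "rate b x = tau * Min ((\<lambda>j. total_grad x j / b j) ` {j. j < n \<and> 0 < b j})"

definition incr :: "vec \<Rightarrow> vec \<Rightarrow> vec" where
  "incr b x j = rate b x * b j / total_grad x j"

definition step :: "vec \<Rightarrow> vec \<Rightarrow> vec" where
  "step b x j = x j + incr b x j * (x j + 1)"

definition micro :: "vec \<Rightarrow> vec \<Rightarrow> vec" where
  "micro b x = (if satisfies n b x then x else step b x)"

definition cover :: "vec \<Rightarrow> vec \<Rightarrow> vec" where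
  "cover b x = (micro b ^^ (LEAST k. satisfies n b ((micro b ^^ k) x))) x"

text \<open>Free coordinates carry no cost, and \<open>total_grad\<close> vanishes there; a row that contains one is
  satisfied by raising it.\<close>

definition has_free :: "vec \<Rightarrow> bool" where
  "has_free b \<longleftrightarrow> (\<exists>j<n. 0 < b j \<and> free j)"

definition row_update :: "vec \<Rightarrow> vec \<Rightarrow> vec" where
  "row_update b x = (if has_free b
     then (\<lambda>j. if j < n \<and> 0 < b j \<and> free j then x j + 1 / b j else x j) else cover b x)"

definition run :: "vec list \<Rightarrow> vec" where
  "run bs = foldl (\<lambda>x b. row_update b x) (\<lambda>_. 0) bs"

definition cost :: "vec \<Rightarrow> real" where
  "cost x = (\<Sum>e\<in>E. c e * lqnorm (q e) (S e) x)"

definition total_primal :: "vec \<Rightarrow> real" where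
  "total_primal x = (\<Sum>e\<in>E. c e * primal_pot M (q e) (S e) x)"

definition total_dual :: "vec \<Rightarrow> vec \<Rightarrow> real" where
  "total_dual y x = (\<Sum>e\<in>E. c e * dual_pot M (q e) (S e) y x)"

definition bounded_row :: "vec \<Rightarrow> bool" where
  "bounded_row b \<longleftrightarrow> (\<Sum>j<n. b j) \<le> 1 \<and> (\<forall>j<n. 0 < b j \<longrightarrow> 1 / M \<le> b j)"

text \<open>The cap \<open>3 * M\<close> is what \<open>dual_pot_diff_le\<close> asks for. The
  factor 6 compares the primal and dual growth of one step, both measured by
  \<open>rate\<close>.\<close>

definition invariant :: "vec \<Rightarrow> vec \<Rightarrow> bool" where
  "invariant y x \<longleftrightarrow> (\<forall>j<n. 0 \<le> x j) \<and> (\<forall>j<n. \<not> free j \<longrightarrow> x j \<le> 3 * M) \<and>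
     total_primal x - total_primal (\<lambda>_. 0) \<le> 6 * (total_dual y x - total_dual y (\<lambda>_. 0))"

end

locale norm_covering = norm_cover +
  assumes M: "1 \<le> M" and E: "finite E"
    and c: "\<And>e. e \<in> E \<Longrightarrow> 0 < c e" and q: "\<And>e. e \<in> E \<Longrightarrow> 1 \<le> q e"
    and S: "\<And>e. e \<in> E \<Longrightarrow> S e \<noteq> {}" "\<And>e. e \<in> E \<Longrightarrow> S e \<subseteq> {..<n}"
    and card_S: "\<And>e. e \<in> E \<Longrightarrow> real (card (S e)) \<le> M"
begin

section \<open>The total gradient and the step size\<close>

lemma finite_S: "e \<in> E \<Longrightarrow> finite (S e)"
  using S(2) finite_subset by blast

lemma norm_term: "e \<in> E \<Longrightarrow> norm_term M (q e) (S e)"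
  using M q S finite_S card_S by unfold_locales auto

text \<open>Exchanging the sums splits a pairing with the total gradient over the terms; this is how
  overlapping sets are accommodated.\<close>

lemma sum_total_grad:
  "(\<Sum>j<n. total_grad x j * w j) = (\<Sum>e\<in>E. c e * (\<Sum>j\<in>S e. grad M (q e) (S e) x j * w j))"
proof -
  have "(\<Sum>j<n. total_grad x j * w j)
      = (\<Sum>j<n. \<Sum>e | e \<in> E \<and> j \<in> S e. c e * (grad M (q e) (S e) x j * w j))"
    by (simp only: total_grad_def sum_distrib_right mult.assoc)
  also have "\<dots> = (\<Sum>e\<in>E. \<Sum>j | j \<in> {..<n} \<and> j \<in> S e. c e * (grad M (q e) (S e) x j * w j))"
    using E by (intro sum.swap_restrict) auto
  also have "\<dots> = (\<Sum>e\<in>E. \<Sum>j\<in>S e. c e * (grad M (q e) (S e) x j * w j))"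
  proof (rule sum.cong[OF refl])
    fix e assume "e \<in> E"
    then have "{j. j \<in> {..<n} \<and> j \<in> S e} = S e" using S(2) by auto
    then show "(\<Sum>j | j \<in> {..<n} \<and> j \<in> S e. c e * (grad M (q e) (S e) x j * w j))
        = (\<Sum>j\<in>S e. c e * (grad M (q e) (S e) x j * w j))" by simp
  qed
  finally show ?thesis by (simp only: sum_distrib_left)
qed

lemma total_grad_pos:
  assumes "\<not> free j" "0 \<le> x j"
  shows "0 < total_grad x j"
  unfolding total_grad_def
proof (rule sum_pos)
  show "finite {e. e \<in> E \<and> j \<in> S e}" using E by simp
  show "{e. e \<in> E \<and> j \<in> S e} \<noteq> {}" using assms(1) by (auto simp: free_def)
  fix e assume "e \<in> {e. e \<in> E \<and> j \<in> S e}"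
  then show "0 < c e * grad M (q e) (S e) x j"
    using c norm_term.grad_pos[OF norm_term, of e x j] assms(2) by simp
qed

lemma sum_q_nonneg: "0 \<le> (\<Sum>e\<in>E. q e)"
  using q by (intro sum_nonneg) force

lemma tau_bounds:
  shows tau_pos: "0 < tau" and tau_le_1: "tau \<le> 1" and tau_q: "e \<in> E \<Longrightarrow> tau * (M\<^sup>2 * q e) \<le> 1"
proof -
  have M2: "1 \<le> M\<^sup>2" using M by simp
  have pos: "0 < M\<^sup>2 * (1 + (\<Sum>e\<in>E. q e))" using M sum_q_nonneg by (intro mult_pos_pos) auto
  then show "0 < tau" by (simp add: tau_def)
  have "1 * 1 \<le> M\<^sup>2 * (1 + (\<Sum>e\<in>E. q e))" using M2 sum_q_nonneg by (intro mult_mono) auto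
  then show "tau \<le> 1" by (simp add: tau_def)
  assume e: "e \<in> E"
  have "q e \<le> (\<Sum>e\<in>E. q e)" using e q E by (intro member_le_sum) force+
  then have "M\<^sup>2 * q e \<le> M\<^sup>2 * (1 + (\<Sum>e\<in>E. q e))" by (intro mult_left_mono) auto
  then show "tau * (M\<^sup>2 * q e) \<le> 1" using divide_le_eq_1_pos[OF pos, of "M\<^sup>2 * q e"]
    by (simp only: tau_def times_divide_eq_left mult_1_left)
qed

section \<open>One step for a row without free coordinates\<close>

context
  fixes b x :: vec
  assumes b: "valid_row n b" "\<not> has_free b" and x: "\<And>j. j < n \<Longrightarrow> 0 \<le> x j"
begin

lemma total_grad_row_pos: "j < n \<Longrightarrow> 0 < b j \<Longrightarrow> 0 < total_grad x j"
  using total_grad_pos[of j x] b(2) x by (auto simp: has_free_def)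

lemma rate_pos: "0 < rate b x"
  and rate_le: "j < n \<Longrightarrow> 0 < b j \<Longrightarrow> rate b x * b j \<le> tau * total_grad x j"
  and rate_attained: "\<exists>j<n. 0 < b j \<and> rate b x * b j = tau * total_grad x j"
proof -
  let ?I = "{j. j < n \<and> 0 < b j}" and ?f = "\<lambda>j. total_grad x j / b j"
  have I: "finite (?f ` ?I)" "?f ` ?I \<noteq> {}" using b(1) by (auto simp: valid_row_def)
  obtain k where k: "k \<in> ?I" "Min (?f ` ?I) = ?f k" using Min_in[OF I] by auto
  then have r: "rate b x = tau * ?f k" by (simp add: rate_def)
  then show "0 < rate b x" using k tau_pos total_grad_row_pos[of k] by simp
  show "\<exists>j<n. 0 < b j \<and> rate b x * b j = tau * total_grad x j"
    using k r by (intro exI[of _ k]) auto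
  assume "j < n" "0 < b j"
  then have "Min (?f ` ?I) \<le> ?f j" using I by (intro Min_le) auto
  from mult_left_mono[OF this less_imp_le[OF tau_pos]]
  have "rate b x \<le> tau * ?f j" by (simp only: rate_def)
  then show "rate b x * b j \<le> tau * total_grad x j" using \<open>0 < b j\<close> by (simp add: field_simps)
qed

lemma incr_bounds:
  assumes "j < n"
  shows "0 \<le> incr b x j" "incr b x j \<le> tau"
proof -
  have "0 \<le> b j" using b(1) assms by (simp add: valid_row_def)
  then consider "b j = 0" | "0 < b j" by linarith
  then have "0 \<le> incr b x j \<and> incr b x j \<le> tau"
  proof cases
    case 2
    then show ?thesis
      using rate_pos rate_le[OF assms 2] total_grad_row_pos[OF assms 2]
      by (simp add: incr_def field_simps)
  qed (use tau_pos in \<open>simp add: incr_def\<close>)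
  then show "0 \<le> incr b x j" "incr b x j \<le> tau" by auto
qed

lemma total_grad_incr: "j < n \<Longrightarrow> total_grad x j * incr b x j = rate b x * b j"
proof -
  assume j: "j < n"
  then have "0 \<le> b j" using b(1) by (simp add: valid_row_def)
  then consider "b j = 0" | "0 < b j" by linarith
  then show ?thesis
    using total_grad_row_pos[OF j] by cases (auto simp: incr_def)
qed

lemma step_ge: "j < n \<Longrightarrow> x j \<le> step b x j"
  using incr_bounds[of j] x[of j] by (simp add: step_def)

text \<open>A coordinate attaining the minimum in \<open>rate\<close> has \<open>incr\<close> equal
  to \<open>tau\<close> and so moves by at least \<open>tau\<close>. This uniform gain forces
  termination.\<close>

lemma step_progress:
  "(\<Sum>j<n. b j * x j) + tau * Min (b ` {j. j < n \<and> 0 < b j}) \<le> (\<Sum>j<n. b j * step b x j)"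
proof -
  let ?I = "{j. j < n \<and> 0 < b j}"
  obtain k where k: "k < n" "0 < b k" "rate b x * b k = tau * total_grad x k"
    using rate_attained by blast
  then have "incr b x k = tau" using total_grad_row_pos[of k] by (simp add: incr_def)
  then have step: "step b x k - x k = tau * (x k + 1)" by (simp add: step_def)
  have "Min (b ` ?I) \<le> b k" using k by (intro Min_le) auto
  then have "tau * Min (b ` ?I) \<le> tau * b k" using tau_pos by simp
  also have "\<dots> \<le> b k * (step b x k - x k)"
    unfolding step using k x[OF k(1)] tau_pos by (simp add: algebra_simps)
  also have "\<dots> \<le> (\<Sum>j<n. b j * (step b x j - x j))"
    using k(1) b(1) step_ge
    by (intro member_le_sum[of k _ "\<lambda>j. b j * (step b x j - x j)"] mult_nonneg_nonneg) (auto simp: valid_row_def)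
  finally show ?thesis by (simp add: right_diff_distrib sum_subtractf)
qed

context
  assumes bd: "bounded_row b" and unsat: "\<not> satisfies n b x"
begin

text \<open>If \<open>j\<close> belongs to the violated row, its entry is at least
  \<open>1 / M\<close>, so \<open>x j \<le> M\<close>, and the step adds at most
  \<open>x j + 1\<close>. Other coordinates do not move.\<close>

lemma step_le:
  assumes j: "j < n" and "x j \<le> 3 * M"
  shows "step b x j \<le> 3 * M"
proof (cases "0 < b j")
  case True
  have "b j * x j \<le> (\<Sum>j<n. b j * x j)"
    using j b(1) x by (intro member_le_sum[of j _ "\<lambda>j. b j * x j"] mult_nonneg_nonneg) (auto simp: valid_row_def)
  then have "b j * x j \<le> 1" using unsat by (simp add: satisfies_def)
  moreover have "1 / M * x j \<le> b j * x j"
    using bd True j x by (intro mult_right_mono) (auto simp: bounded_row_def)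
  ultimately have "1 / M * x j \<le> 1" by linarith
  then have "x j \<le> M" using M by (simp add: field_simps)
  moreover have "incr b x j * (x j + 1) \<le> 1 * (x j + 1)"
    using incr_bounds[OF j] tau_le_1 x[OF j] by (intro mult_right_mono) auto
  ultimately show ?thesis using M by (simp add: step_def)
next
  case False
  then have "b j = 0" using b(1) j unfolding valid_row_def by force
  then show ?thesis using assms by (simp add: step_def incr_def)
qed

lemma step_in_S:
  assumes e: "e \<in> E"
  shows "primal_pot M (q e) (S e) (step b x) - primal_pot M (q e) (S e) x
      \<le> 3 * (\<Sum>j\<in>S e. grad M (q e) (S e) x j * (step b x j - x j))"
    and "(\<And>j. j < n \<Longrightarrow> 0 \<le> y j) \<Longrightarrow> (\<Sum>j\<in>S e. grad M (q e) (S e) x j * (incr b x j * y j))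
      \<le> dual_pot M (q e) (S e) y (step b x) - dual_pot M (q e) (S e) y x"
proof -
  have n: "j < n" if "j \<in> S e" for j using S(2)[OF e] that by auto
  note facts = tau_q[OF e] x[OF n] conjI[OF incr_bounds[OF n]] step_def
  show "primal_pot M (q e) (S e) (step b x) - primal_pot M (q e) (S e) x
      \<le> 3 * (\<Sum>j\<in>S e. grad M (q e) (S e) x j * (step b x j - x j))"
    by (rule norm_term.primal_step[OF norm_term[OF e], of tau x "incr b x"]) (use facts in auto)
  assume "\<And>j. j < n \<Longrightarrow> 0 \<le> y j"
  then have y: "0 \<le> y j" if "j \<in> S e" for j using n[OF that] by simp
  have "(\<Sum>j\<in>S e. grad M (q e) (S e) x j * incr b x j * y j)
      \<le> dual_pot M (q e) (S e) y (step b x) - dual_pot M (q e) (S e) y x"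
    by (rule norm_term.dual_step[OF norm_term[OF e], of tau x "incr b x"]) (use facts y in auto)
  then show "(\<Sum>j\<in>S e. grad M (q e) (S e) x j * (incr b x j * y j))
      \<le> dual_pot M (q e) (S e) y (step b x) - dual_pot M (q e) (S e) y x"
    by (simp only: mult.assoc)
qed

text \<open>The pairing of the total gradient with the step is \<open>rate b x\<close> times the sum
  of \<open>b j * (x j + 1)\<close>. Violation of the row bounds one half of this sum by 1, the
  scaling of the row the other half.\<close>

lemma total_primal_step: "total_primal (step b x) - total_primal x \<le> 6 * rate b x"
proof -
  have "total_primal (step b x) - total_primal x
      = (\<Sum>e\<in>E. c e * (primal_pot M (q e) (S e) (step b x) - primal_pot M (q e) (S e) x))"
    by (simp add: total_primal_def right_diff_distrib sum_subtractf)
  also have "\<dots> \<le> (\<Sum>e\<in>E. c e * (3 * (\<Sum>j\<in>S e. grad M (q e) (S e) x j * (step b x j - x j))))"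
    using step_in_S(1) c by (intro sum_mono mult_left_mono) (auto intro: less_imp_le)
  also have "\<dots> = 3 * (\<Sum>j<n. total_grad x j * (step b x j - x j))"
    unfolding sum_total_grad sum_distrib_left by (simp only: mult.left_commute)
  also have "(\<Sum>j<n. total_grad x j * (step b x j - x j)) = (\<Sum>j<n. rate b x * (b j * x j + b j))"
  proof (intro sum.cong refl)
    fix j assume "j \<in> {..<n}"
    then have "total_grad x j * incr b x j * (x j + 1) = rate b x * b j * (x j + 1)"
      using total_grad_incr by simp
    then show "total_grad x j * (step b x j - x j) = rate b x * (b j * x j + b j)"
      by (simp add: step_def algebra_simps)
  qed
  also have "\<dots> = rate b x * ((\<Sum>j<n. b j * x j) + (\<Sum>j<n. b j))"
    by (simp only: sum_distrib_left[symmetric] sum.distrib)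
  also have "3 * \<dots> \<le> 3 * (rate b x * 2)"
    using unsat bd rate_pos by (intro mult_left_mono) (auto simp: satisfies_def bounded_row_def)
  finally show ?thesis by simp
qed

text \<open>As \<open>y\<close> satisfies the row, \<open>rate b x\<close> is at most
  \<open>rate b x\<close> times the row value at \<open>y\<close>. By the choice of
  \<open>incr\<close> this is a pairing with the total gradient, to which \<open>dual_step\<close>
  applies term by term.\<close>

lemma total_dual_step:
  assumes y: "\<And>j. j < n \<Longrightarrow> 0 \<le> y j" "satisfies n b y"
  shows "rate b x \<le> total_dual y (step b x) - total_dual y x"
proof -
  have "rate b x * 1 \<le> rate b x * (\<Sum>j<n. b j * y j)"
    using rate_pos y(2) by (intro mult_left_mono) (auto simp: satisfies_def)
  also have "\<dots> = (\<Sum>j<n. total_grad x j * (incr b x j * y j))"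
    unfolding sum_distrib_left
  proof (intro sum.cong refl)
    fix j assume "j \<in> {..<n}"
    then show "rate b x * (b j * y j) = total_grad x j * (incr b x j * y j)"
      using total_grad_incr[of j] by (simp only: mult.assoc[symmetric] lessThan_iff)
  qed
  also have "\<dots> = (\<Sum>e\<in>E. c e * (\<Sum>j\<in>S e. grad M (q e) (S e) x j * (incr b x j * y j)))"
    by (rule sum_total_grad)
  also have "\<dots> \<le> (\<Sum>e\<in>E. c e * (dual_pot M (q e) (S e) y (step b x) - dual_pot M (q e) (S e) y x))"
    using step_in_S(2)[of _ y] y c by (intro sum_mono mult_left_mono) (auto intro: less_imp_le)
  also have "\<dots> = total_dual y (step b x) - total_dual y x"
    by (simp add: total_dual_def right_diff_distrib sum_subtractf)
  finally show ?thesis by simp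
qed

end

end

section \<open>Repeating steps until the row holds\<close>

lemma micro_invariant:
  assumes "valid_row n b" "\<not> has_free b" "bounded_row b"
    and y: "\<And>j. j < n \<Longrightarrow> 0 \<le> y j" "satisfies n b y" and inv: "invariant y x"
  shows "invariant y (micro b x)"
proof (cases "satisfies n b x")
  case False
  have x: "\<And>j. j < n \<Longrightarrow> 0 \<le> x j" "\<And>j. j < n \<Longrightarrow> \<not> free j \<Longrightarrow> x j \<le> 3 * M"
    using inv by (auto simp: invariant_def)
  have "0 \<le> step b x j" if "j < n" for j
    using step_ge[of b x j] assms x(1) that order_trans by blast
  moreover have "step b x j \<le> 3 * M" if "j < n" "\<not> free j" for j
    using step_le[of b x j] assms x that False by blast
  moreover have "total_primal (step b x) - total_primal x \<le> 6 * rate b x"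
    using total_primal_step[of b x] assms x False by blast
  moreover have "rate b x \<le> total_dual y (step b x) - total_dual y x"
    using total_dual_step[of b x y] assms x False by blast
  ultimately show ?thesis using inv False by (simp add: invariant_def micro_def)
qed (use inv in \<open>simp add: micro_def\<close>)

lemma micro_ge:
  assumes "valid_row n b" "\<not> has_free b" "\<And>j. j < n \<Longrightarrow> 0 \<le> x j" "j < n"
  shows "x j \<le> micro b x j"
  using step_ge[of b x j] assms by (simp add: micro_def)

lemma micro_iter_ge:
  assumes b: "valid_row n b" "\<not> has_free b" and x: "\<And>j. j < n \<Longrightarrow> 0 \<le> x j" and j: "j < n"
  shows "x j \<le> (micro b ^^ k) x j"
  using j
proof (induction k arbitrary: j)
  case (Suc k)
  have "0 \<le> (micro b ^^ k) x i" if "i < n" for i using Suc.IH[OF that] x[OF that] by linarith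
  then have "(micro b ^^ k) x j \<le> micro b ((micro b ^^ k) x) j"
    using micro_ge[OF b] Suc.prems by blast
  then show ?case using Suc.IH[OF Suc.prems] by simp
qed simp

text \<open>Otherwise each step would add the same positive amount to the row value, which would
  eventually exceed 1. Hence the least number of steps in \<open>cover\<close> exists.\<close>

lemma micro_iter_satisfies:
  assumes b: "valid_row n b" "\<not> has_free b" and x: "\<And>j. j < n \<Longrightarrow> 0 \<le> x j"
  shows "\<exists>k. satisfies n b ((micro b ^^ k) x)"
proof (rule ccontr)
  assume "\<not> ?thesis"
  then have unsat: "\<not> satisfies n b ((micro b ^^ k) x)" for k by blast
  let ?I = "{j. j < n \<and> 0 < b j}"
  let ?d = "tau * Min (b ` ?I)"
  have "Min (b ` ?I) \<in> b ` ?I" using b(1) by (intro Min_in) (auto simp: valid_row_def)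
  then have d: "0 < ?d" using tau_pos by auto
  have pos: "0 \<le> (micro b ^^ k) x j" if "j < n" for k j
    using micro_iter_ge[of b x j k] b x[of j] x that by fastforce
  have lower: "real k * ?d \<le> (\<Sum>j<n. b j * (micro b ^^ k) x j)" for k
  proof (induction k)
    case 0
    then show ?case using b(1) x by (auto simp: valid_row_def intro!: sum_nonneg)
  next
    case (Suc k)
    have "micro b ((micro b ^^ k) x) = step b ((micro b ^^ k) x)" using unsat by (simp add: micro_def)
    then have "(\<Sum>j<n. b j * (micro b ^^ k) x j) + ?d \<le> (\<Sum>j<n. b j * (micro b ^^ Suc k) x j)"
      using step_progress[of b "(micro b ^^ k) x"] b pos by simp
    then show ?case using Suc by (simp add: algebra_simps)
  qed
  obtain k where "1 \<le> real k * ?d"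
    using reals_Archimedean3[OF d] by (metis less_imp_le)
  then show False using lower[of k] unsat[of k] by (simp add: satisfies_def)
qed

lemma row_update_ge:
  assumes "valid_row n b" "\<And>j. j < n \<Longrightarrow> 0 \<le> x j" "j < n"
  shows "x j \<le> row_update b x j"
  using assms micro_iter_ge[of b x j] by (auto simp: row_update_def cover_def)

lemma row_update_satisfies:
  assumes b: "valid_row n b" and x: "\<And>j. j < n \<Longrightarrow> 0 \<le> x j"
  shows "satisfies n b (row_update b x)"
proof (cases "has_free b")
  case True
  then obtain k where k: "k < n" "0 < b k" "free k" by (auto simp: has_free_def)
  have "1 \<le> b k * row_update b x k"
    using True k x[OF k(1)] by (simp add: row_update_def distrib_left)
  also have "\<dots> \<le> (\<Sum>j<n. b j * row_update b x j)"
  proof (rule member_le_sum[of k _ "\<lambda>j. b j * row_update b x j"])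
    fix j assume "j \<in> {..<n} - {k}"
    then have "j < n" by simp
    then have "0 \<le> row_update b x j" using row_update_ge[OF b, of x j] x by (meson order_trans)
    then show "0 \<le> b j * row_update b x j"
      using b \<open>j < n\<close> by (simp add: valid_row_def)
  qed (use k in auto)
  finally show ?thesis by (simp add: satisfies_def)
next
  case False
  then show ?thesis
    using LeastI_ex[OF micro_iter_satisfies[of b x]] b False x by (simp add: row_update_def cover_def)
qed

text \<open>Free coordinates lie in no \<open>S e\<close>, so raising them changes no potential;
  without them the invariant survives every single step.\<close>

lemma row_update_invariant:
  assumes b: "valid_row n b" "bounded_row b"
    and y: "\<And>j. j < n \<Longrightarrow> 0 \<le> y j" "satisfies n b y" and inv: "invariant y x"
  shows "invariant y (row_update b x)"
proof (cases "has_free b")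
  case True
  have nonfree: "row_update b x j = x j" if "\<not> free j" for j
    using True that by (simp add: row_update_def)
  have S: "row_update b x j = x j" if "e \<in> E" "j \<in> S e" for e j
    using that by (intro nonfree) (auto simp: free_def)
  have "total_primal (row_update b x) = total_primal x"
    unfolding total_primal_def using S
    by (intro sum.cong refl arg_cong2[where f = "(*)"] primal_pot_cong) auto
  moreover have "total_dual y (row_update b x) = total_dual y x"
    unfolding total_dual_def using S
    by (intro sum.cong refl arg_cong2[where f = "(*)"] dual_pot_cong) auto
  moreover have "0 \<le> row_update b x j" if "j < n" for j
    using row_update_ge[OF b(1), of x j] inv that by (fastforce simp: invariant_def)
  ultimately show ?thesis using inv nonfree by (simp add: invariant_def)
next
  case False
  have "invariant y ((micro b ^^ k) x)" for k
    by (induction k) (use inv micro_invariant[OF b(1) False b(2) y] in auto)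
  then show ?thesis using False by (simp add: row_update_def cover_def)
qed

section \<open>The run over all rows\<close>

lemma run_Nil: "run [] = (\<lambda>_. 0)"
  by (simp add: run_def)

lemma run_snoc: "run (bs @ [b]) = row_update b (run bs)"
  by (simp add: run_def)

lemma run_nonneg: "valid_rows n bs \<Longrightarrow> j < n \<Longrightarrow> 0 \<le> run bs j"
proof (induction bs arbitrary: j rule: rev_induct)
  case (snoc b bs)
  then have "run bs j \<le> run (bs @ [b]) j"
    unfolding run_snoc by (intro row_update_ge) (auto simp: valid_rows_def)
  then show ?case using snoc by (force simp: valid_rows_def)
qed (simp add: run_Nil)

lemma run_ge: "valid_rows n (bs @ [b]) \<Longrightarrow> j < n \<Longrightarrow> run bs j \<le> run (bs @ [b]) j"
  unfolding run_snoc using run_nonneg[of bs] by (intro row_update_ge) (auto simp: valid_rows_def)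

lemma run_satisfies: "valid_rows n bs \<Longrightarrow> b \<in> set bs \<Longrightarrow> satisfies n b (run bs)"
proof (induction bs rule: rev_induct)
  case (snoc b' bs)
  then have v: "valid_rows n bs" "valid_row n b'" "valid_row n b" by (auto simp: valid_rows_def)
  show ?case
  proof (cases "b \<in> set bs")
    case True
    then show ?thesis using satisfies_mono[OF v(3) snoc.IH] run_ge snoc.prems(1) v(1) by blast
  next
    case False
    then have "b = b'" using snoc.prems by simp
    then show ?thesis using row_update_satisfies[OF v(2)] run_nonneg[OF v(1)] by (simp add: run_snoc)
  qed
qed simp

lemma run_invariant:
  assumes "valid_rows n bs" "\<And>b. b \<in> set bs \<Longrightarrow> bounded_row b"
    and y: "\<And>j. j < n \<Longrightarrow> 0 \<le> y j" "\<And>b. b \<in> set bs \<Longrightarrow> satisfies n b y"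
  shows "invariant y (run bs)"
  using assms(1,2,4)
proof (induction bs rule: rev_induct)
  case Nil
  then show ?case using M by (simp add: run_Nil invariant_def)
next
  case (snoc b bs)
  then show ?case
    unfolding run_snoc using y(1) by (intro row_update_invariant) (auto simp: valid_rows_def)
qed

text \<open>The cost is at most 3 times the primal growth, which is at most 6 times the dual growth,
  which is at most \<open>10 * (1 + ln M)\<close> times the cost of \<open>y\<close>.\<close>

theorem run_cost:
  assumes bs: "valid_rows n bs" "\<And>b. b \<in> set bs \<Longrightarrow> bounded_row b"
    and y: "\<And>j. j < n \<Longrightarrow> 0 \<le> y j" "\<And>b. b \<in> set bs \<Longrightarrow> satisfies n b y"
  shows "cost (run bs) \<le> 180 * (1 + ln M) * cost y"
proof -
  let ?x = "run bs"
  have inv: "invariant y ?x" using run_invariant assms by blast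
  have "cost ?x \<le> (\<Sum>e\<in>E. c e * (3 * (primal_pot M (q e) (S e) ?x - primal_pot M (q e) (S e) (\<lambda>_. 0))))"
    unfolding cost_def
  proof (intro sum_mono mult_left_mono)
    fix e assume e: "e \<in> E"
    show "lqnorm (q e) (S e) ?x \<le> 3 * (primal_pot M (q e) (S e) ?x - primal_pot M (q e) (S e) (\<lambda>_. 0))"
      using S(2)[OF e] run_nonneg[OF bs(1)]
      by (intro norm_term.lqnorm_le_primal_pot[OF norm_term[OF e]]) auto
  qed (use c in \<open>auto intro: less_imp_le\<close>)
  also have "\<dots> = 3 * (total_primal ?x - total_primal (\<lambda>_. 0))"
    unfolding total_primal_def sum_subtractf[symmetric] sum_distrib_left
    by (intro sum.cong refl) (simp add: algebra_simps)
  also have "\<dots> \<le> 3 * (6 * (total_dual y ?x - total_dual y (\<lambda>_. 0)))"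
    using inv by (simp add: invariant_def)
  also have "total_dual y ?x - total_dual y (\<lambda>_. 0) \<le> (10 + 10 * ln M) * cost y"
  proof -
    have "total_dual y ?x - total_dual y (\<lambda>_. 0)
        = (\<Sum>e\<in>E. c e * (dual_pot M (q e) (S e) y ?x - dual_pot M (q e) (S e) y (\<lambda>_. 0)))"
      by (simp add: total_dual_def right_diff_distrib sum_subtractf)
    also have "\<dots> \<le> (\<Sum>e\<in>E. c e * ((10 + 10 * ln M) * lqnorm (q e) (S e) y))"
    proof (intro sum_mono mult_left_mono)
      fix e assume e: "e \<in> E"
      have "0 \<le> ?x j \<and> ?x j \<le> 3 * M" "0 \<le> y j" if "j \<in> S e" for j
      proof -
        have "j < n" "\<not> free j" using that S(2)[OF e] e by (auto simp: free_def)
        then show "0 \<le> ?x j \<and> ?x j \<le> 3 * M" "0 \<le> y j" using inv y(1) by (auto simp: invariant_def)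
      qed
      then show "dual_pot M (q e) (S e) y ?x - dual_pot M (q e) (S e) y (\<lambda>_. 0)
          \<le> (10 + 10 * ln M) * lqnorm (q e) (S e) y"
        by (rule norm_term.dual_pot_diff_le[OF norm_term[OF e]])
    qed (use c in \<open>auto intro: less_imp_le\<close>)
    also have "\<dots> = (10 + 10 * ln M) * cost y"
      unfolding cost_def sum_distrib_left by (simp only: mult.left_commute)
    finally show ?thesis .
  qed
  finally show ?thesis by (simp add: algebra_simps)
qed

end

section \<open>Objectives and instances\<close>

abbreviation coef :: "objective \<Rightarrow> nat \<Rightarrow> real" where
  "coef F e \<equiv> fst (F ! e)"

abbreviation supp :: "objective \<Rightarrow> nat \<Rightarrow> nat set" where
  "supp F e \<equiv> fst (snd (F ! e))"

abbreviation expo :: "objective \<Rightarrow> nat \<Rightarrow> real" where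
  "expo F e \<equiv> snd (snd (F ! e))"

text \<open>The terms dropped cost nothing; without them the positivity and nonemptiness in
  \<open>norm_covering\<close> hold, and a coordinate seen only by zero coefficients counts as
  free.\<close>

definition active :: "objective \<Rightarrow> nat set" where
  "active F = {e. e < length F \<and> 0 < coef F e \<and> supp F e \<noteq> {}}"

lemma objf_eq_sum: "objf F x = (\<Sum>e<length F. coef F e * lqnorm (expo F e) (supp F e) x)"
  by (simp add: objf_def sum_list_sum_nth atLeast0LessThan case_prod_beta)

lemma valid_obj_nth:
  assumes "valid_obj n F" "e < length F"
  shows "0 \<le> coef F e" "1 \<le> expo F e" "supp F e \<subseteq> {..<n}"
proof -
  obtain c S q where e: "F ! e = (c, S, q)" by (cases "F ! e")
  then have "(c, S, q) \<in> set F" using nth_mem[OF assms(2)] by simp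
  with assms(1) have "0 \<le> c \<and> 1 \<le> q \<and> S \<subseteq> {..<n}" unfolding valid_obj_def by blast
  then show "0 \<le> coef F e" "1 \<le> expo F e" "supp F e \<subseteq> {..<n}" by (simp_all add: e)
qed

lemma objf_nonneg: "valid_obj n F \<Longrightarrow> 0 \<le> objf F x"
  unfolding objf_eq_sum using valid_obj_nth(1) lqnorm_nonneg by (intro sum_nonneg mult_nonneg_nonneg) auto

lemma objf_zero [simp]: "objf F (\<lambda>_. 0) = 0"
  by (simp add: objf_eq_sum lqnorm_zero)

lemma objf_mono:
  assumes F: "valid_obj n F" and x: "\<And>j. j < n \<Longrightarrow> 0 \<le> x j \<and> x j \<le> y j"
  shows "objf F x \<le> objf F y"
  unfolding objf_eq_sum
proof (intro sum_mono mult_left_mono lqnorm_mono)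
  fix e assume "e \<in> {..<length F}"
  note e = valid_obj_nth[OF F, of e]
  with \<open>e \<in> _\<close> show "0 \<le> coef F e" "1 \<le> expo F e" by auto
  fix j assume "j \<in> supp F e"
  with e \<open>e \<in> _\<close> have "j < n" by auto
  with x show "0 \<le> x j" "x j \<le> y j" by auto
qed

lemma objf_scale:
  assumes "valid_obj n F" "0 \<le> k"
  shows "objf F (\<lambda>j. k * x j) = k * objf F x"
  unfolding objf_eq_sum sum_distrib_left
  using valid_obj_nth(2)[OF assms(1)] assms(2) by (intro sum.cong) (auto simp: lqnorm_scale)

text \<open>The maximum is below the sum, and the triangle inequality applies to each term.\<close>

lemma objf_max_le:
  assumes F: "valid_obj n F" and u: "\<And>j. j < n \<Longrightarrow> 0 \<le> u j" and v: "\<And>j. j < n \<Longrightarrow> 0 \<le> v j"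
  shows "objf F (\<lambda>j. max (u j) (v j)) \<le> objf F u + objf F v"
proof -
  have "objf F (\<lambda>j. max (u j) (v j)) \<le> objf F (\<lambda>j. u j + v j)"
    using u v by (intro objf_mono[OF F]) (auto simp: max_def add_increasing add_increasing2)
  also have "\<dots> \<le> (\<Sum>e<length F. coef F e * (lqnorm (expo F e) (supp F e) u + lqnorm (expo F e) (supp F e) v))"
    unfolding objf_eq_sum
  proof (intro sum_mono mult_left_mono lqnorm_triangle)
    fix e assume "e \<in> {..<length F}"
    note e = valid_obj_nth[OF F, of e]
    with \<open>e \<in> _\<close> show "0 \<le> coef F e" "1 \<le> expo F e" "finite (supp F e)"
      using finite_subset by auto
    fix j assume "j \<in> supp F e"
    with e \<open>e \<in> _\<close> have "j < n" by auto
    with u v show "0 \<le> u j" "0 \<le> v j" by auto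
  qed
  also have "\<dots> = objf F u + objf F v"
    by (simp add: objf_eq_sum distrib_left sum.distrib)
  finally show ?thesis .
qed

lemma objf_eq_cost:
  assumes F: "valid_obj n F"
  shows "objf F x = norm_cover.cost (active F) (coef F) (supp F) (expo F) x"
  unfolding norm_cover.cost_def objf_eq_sum
proof (rule sum.mono_neutral_right)
  show "\<forall>e\<in>{..<length F} - active F. coef F e * lqnorm (expo F e) (supp F e) x = 0"
    using valid_obj_nth(1)[OF F] by (force simp: active_def lqnorm_def)
qed (auto simp: active_def)

lemma satisfies_max:
  assumes "valid_row n a" "satisfies n a x \<or> satisfies n a y"
  shows "satisfies n a (\<lambda>j. max (x j) (y j))"
  using assms satisfies_mono[OF assms(1)] by (metis max.cobounded1 max.cobounded2)

lemma valid_rows_snoc: "valid_rows n (As @ [a]) \<longleftrightarrow> valid_rows n As \<and> valid_row n a"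
  by (auto simp: valid_rows_def)

section \<open>Nonzero entries and the parameters \<kappa> and d\<close>

lemma nz_entriesI: "a \<in> set As \<Longrightarrow> j < n \<Longrightarrow> 0 < a j \<Longrightarrow> a j \<in> nz_entries n As"
  unfolding nz_entries_def by blast

lemma finite_nz_entries: "finite (nz_entries n As)"
proof -
  have "nz_entries n As \<subseteq> (\<lambda>(a, j). a j) ` (set As \<times> {..<n})" by (auto simp: nz_entries_def)
  then show ?thesis by (rule finite_subset) auto
qed

lemma nz_entries_nonempty:
  assumes "valid_rows n As" "As \<noteq> []"
  shows "nz_entries n As \<noteq> {}"
proof -
  have "valid_row n (hd As)" using assms by (simp add: valid_rows_def)
  then show ?thesis using assms(2) nz_entriesI[of "hd As" As] by (fastforce simp: valid_row_def)
qed

context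
  fixes n :: nat and F :: objective and As :: "vec list"
  assumes F: "valid_obj n F" and As: "valid_rows n As" "As \<noteq> []"
begin

lemma Min_nz_entries_pos: "0 < Min (nz_entries n As)"
  using finite_nz_entries[of n As] nz_entries_nonempty[OF As]
  by (subst Min_gr_iff) (auto simp: nz_entries_def)

lemma nz_entries_ratio:
  assumes "s \<in> nz_entries n As" "t \<in> nz_entries n As"
  shows "s \<le> kappa n As * t"
proof -
  have "s \<le> Max (nz_entries n As)" using assms finite_nz_entries by simp
  also have "\<dots> = kappa n As * Min (nz_entries n As)"
    using Min_nz_entries_pos by (simp add: kappa_def)
  also have "\<dots> \<le> kappa n As * t"
  proof (rule mult_left_mono)
    have "Min (nz_entries n As) \<le> Max (nz_entries n As)"
      using finite_nz_entries nz_entries_nonempty[OF As] by simp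
    then show "0 \<le> kappa n As" using Min_nz_entries_pos by (simp add: kappa_def)
  qed (use assms finite_nz_entries in simp)
  finally show ?thesis .
qed

lemma kappa_ge_1: "1 \<le> kappa n As"
proof -
  have "Min (nz_entries n As) \<le> Max (nz_entries n As)"
    using finite_nz_entries nz_entries_nonempty[OF As] by simp
  then show ?thesis using Min_nz_entries_pos by (simp add: kappa_def)
qed

lemma row_card_le_dpar: "a \<in> set As \<Longrightarrow> card {j. j < n \<and> 0 < a j} \<le> dpar n F As"
  unfolding dpar_def by (intro max.coboundedI1 Max_ge) auto

lemma supp_card_le_dpar: "e < length F \<Longrightarrow> card (supp F e) \<le> dpar n F As"
  unfolding dpar_def by (intro max.coboundedI2 Max_ge) (auto simp: case_prod_beta)

lemma dpar_ge_1: "1 \<le> dpar n F As"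
proof -
  have "valid_row n (hd As)" using As by (simp add: valid_rows_def)
  then have "{j. j < n \<and> 0 < hd As j} \<noteq> {}" by (auto simp: valid_row_def)
  then have "0 < card {j. j < n \<and> 0 < hd As j}" by (simp add: card_gt_0_iff)
  then show ?thesis using row_card_le_dpar[of "hd As"] As by simp
qed

lemma dpar_le_prod: "real (dpar n F As) \<le> kappa n As * real (dpar n F As)"
  using kappa_ge_1 mult_right_mono[of 1 "kappa n As" "real (dpar n F As)"] by simp

lemma kappa_le_prod: "kappa n As \<le> kappa n As * real (dpar n F As)"
  using kappa_ge_1 dpar_ge_1 mult_left_mono[of 1 "real (dpar n F As)" "kappa n As"] by simp

lemma prod_ge_1: "1 \<le> kappa n As * real (dpar n F As)"
  using kappa_ge_1 kappa_le_prod by linarith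

text \<open>A new row only enlarges the sets over which extrema are taken, so both \<kappa> and d
  can only grow.\<close>

lemma prod_snoc_le:
  assumes a: "valid_row n a"
  shows "kappa n As * real (dpar n F As) \<le> kappa n (As @ [a]) * real (dpar n F (As @ [a]))"
proof (rule mult_mono)
  have sub: "nz_entries n As \<subseteq> nz_entries n (As @ [a])" by (auto simp: nz_entries_def)
  have ne: "nz_entries n As \<noteq> {}" "nz_entries n (As @ [a]) \<noteq> {}"
    using nz_entries_nonempty[OF As] sub by auto
  have "0 < Min (nz_entries n (As @ [a]))"
    using finite_nz_entries[of n "As @ [a]"] ne by (subst Min_gr_iff) (auto simp: nz_entries_def)
  moreover have "Max (nz_entries n As) \<le> Max (nz_entries n (As @ [a]))"
    using sub ne finite_nz_entries by (intro Max_mono) auto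
  moreover have "Min (nz_entries n (As @ [a])) \<le> Min (nz_entries n As)"
    using sub ne finite_nz_entries by (intro Min_antimono) auto
  moreover have "0 < Max (nz_entries n As)"
    using Min_nz_entries_pos Max_ge[OF finite_nz_entries Min_in[OF finite_nz_entries ne(1)]]
    by linarith
  ultimately show k: "kappa n As \<le> kappa n (As @ [a])"
    unfolding kappa_def by (intro frac_le) auto
  then show "0 \<le> kappa n (As @ [a])" using kappa_ge_1 by linarith
  have "dpar n F As \<le> dpar n F (As @ [a])"
    unfolding dpar_def by (intro max.mono Max_mono order_refl) auto
  then show "real (dpar n F As) \<le> real (dpar n F (As @ [a]))" by simp
qed simp

end

section \<open>Guessing the parameter\<close>

text \<open>With a guess \<open>K\<close> for \<open>\<kappa> d\<close>, the largest entry of the first row fixes a scale in which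
  all rows have entries in \<open>[1/K\<^sup>2, 1]\<close> and entry sum at most 1.\<close>

definition row_scale :: "nat \<Rightarrow> real \<Rightarrow> vec list \<Rightarrow> real" where
  "row_scale n K As = 1 / (Max (hd As ` {..<n}) * K)"

text \<open>All revealed rows are replayed from zero, independently of other guesses. The parameter
  is \<open>K\<^sup>2\<close> because scaled entries may be as small as
  \<open>1 / K\<^sup>2\<close>.\<close>

definition phase :: "nat \<Rightarrow> objective \<Rightarrow> real \<Rightarrow> vec list \<Rightarrow> vec" where
  "phase n F K As = (\<lambda>j. row_scale n K As *
     norm_cover.run (active F) (coef F) (supp F) (expo F) n (K\<^sup>2) (map (\<lambda>a j. row_scale n K As * a j) As) j)"

lemma phase_Nil: "phase n F K [] = (\<lambda>_. 0)"
  by (simp add: phase_def norm_cover.run_def)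

context
  fixes n :: nat and F :: objective and As :: "vec list" and K :: real
  assumes F: "valid_obj n F" and As: "valid_rows n As" "As \<noteq> []"
    and K: "kappa n As * real (dpar n F As) \<le> K"
begin

lemma guess_ge_1: "1 \<le> K"
  using prod_ge_1[OF F As] K by linarith

lemma norm_covering: "norm_covering (active F) (coef F) (supp F) (expo F) n (K\<^sup>2)"
proof
  show "1 \<le> K\<^sup>2" using guess_ge_1 by simp
  show "finite (active F)" by (simp add: active_def)
  fix e assume e: "e \<in> active F"
  then show "0 < coef F e" "1 \<le> expo F e" "supp F e \<noteq> {}" "supp F e \<subseteq> {..<n}"
    using valid_obj_nth[OF F, of e] by (auto simp: active_def)
  have "real (card (supp F e)) \<le> real (dpar n F As)"
    using supp_card_le_dpar[OF F As, of e] e by (simp add: active_def)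
  also have "\<dots> \<le> K" using dpar_le_prod[OF F As] K by linarith
  also have "\<dots> \<le> K\<^sup>2" using guess_ge_1 by (simp add: power2_eq_square)
  finally show "real (card (supp F e)) \<le> K\<^sup>2" .
qed

lemma head_entry: "Max (hd As ` {..<n}) \<in> nz_entries n As"
proof -
  have v: "valid_row n (hd As)" using As by (simp add: valid_rows_def)
  then obtain k where k: "k < n" "0 < hd As k" by (auto simp: valid_row_def)
  then have "Max (hd As ` {..<n}) \<in> hd As ` {..<n}" by (intro Max_in) auto
  then obtain l where l: "l < n" "Max (hd As ` {..<n}) = hd As l" by blast
  have "hd As k \<le> Max (hd As ` {..<n})" using k by (intro Max_ge) auto
  then have "0 < hd As l" using k l by simp
  then show ?thesis unfolding l(2) using l(1) As(2) by (intro nz_entriesI) auto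
qed

lemma head_entry_pos: "0 < Max (hd As ` {..<n})"
  using head_entry by (auto simp: nz_entries_def)

lemma row_scale_pos: "0 < row_scale n K As"
  using head_entry_pos guess_ge_1 by (simp add: row_scale_def)

lemma scaled_row_valid: "a \<in> set As \<Longrightarrow> valid_row n (\<lambda>j. row_scale n K As * a j)"
  using As row_scale_pos by (simp add: valid_rows_def valid_row_def zero_less_mult_iff)

text \<open>Let m be the largest entry of the first row. A row has at most d nonzero entries, each
  at most \<kappa> m, so their sum is at most K m; each is at least m / \<kappa>, hence at least m /
  K. The scale divides by K m.\<close>

lemma scaled_row_bounded:
  assumes a: "a \<in> set As"
  shows "norm_cover.bounded_row n (K\<^sup>2) (\<lambda>j. row_scale n K As * a j)"
  unfolding norm_cover.bounded_row_def
proof (intro conjI allI impI)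
  let ?m = "Max (hd As ` {..<n})" and ?I = "{j. j < n \<and> 0 < a j}"
  have v: "valid_row n a" using As a by (simp add: valid_rows_def)
  have nz: "a j \<in> nz_entries n As" if "j \<in> ?I" for j using that a by (auto simp: nz_entries_def)
  have "(\<Sum>j<n. a j) = (\<Sum>j\<in>?I. a j)"
    using v by (intro sum.mono_neutral_right) (force simp: valid_row_def)+
  also have "\<dots> \<le> real (card ?I) * (kappa n As * ?m)"
    using nz_entries_ratio[OF F As nz head_entry] by (intro sum_bounded_above)
  also have "\<dots> \<le> real (dpar n F As) * (kappa n As * ?m)"
    using row_card_le_dpar[OF F As a] kappa_ge_1[OF F As] head_entry_pos
    by (intro mult_right_mono) auto
  also have "\<dots> = (kappa n As * real (dpar n F As)) * ?m" by simp
  also have "\<dots> \<le> K * ?m" using K head_entry_pos by (intro mult_right_mono) auto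
  finally show "(\<Sum>j<n. row_scale n K As * a j) \<le> 1"
    using head_entry_pos guess_ge_1
    by (simp add: row_scale_def field_simps flip: sum_distrib_left sum_divide_distrib)
  fix j assume "j < n" "0 < row_scale n K As * a j"
  then have j: "j \<in> ?I" using row_scale_pos by (simp add: zero_less_mult_iff)
  have "?m \<le> kappa n As * a j" by (rule nz_entries_ratio[OF F As head_entry nz[OF j]])
  also have "\<dots> \<le> K * a j"
    using kappa_le_prod[OF F As] K j by (intro mult_right_mono) auto
  finally show "1 / K\<^sup>2 \<le> row_scale n K As * a j"
    using head_entry_pos guess_ge_1 by (simp add: row_scale_def field_simps power2_eq_square)
qed

lemma scaled_rows_valid: "valid_rows n (map (\<lambda>a j. row_scale n K As * a j) As)"
  using scaled_row_valid by (auto simp: valid_rows_def)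

lemma phase_nonneg: "j < n \<Longrightarrow> 0 \<le> phase n F K As j"
  using norm_covering.run_nonneg[OF norm_covering scaled_rows_valid] row_scale_pos by (simp add: phase_def)

lemma phase_satisfies:
  assumes a: "a \<in> set As"
  shows "satisfies n a (phase n F K As)"
proof -
  have "satisfies n (\<lambda>j. row_scale n K As * a j) (norm_cover.run (active F) (coef F) (supp F) (expo F) n (K\<^sup>2)
      (map (\<lambda>a j. row_scale n K As * a j) As))"
    using a by (intro norm_covering.run_satisfies[OF norm_covering scaled_rows_valid]) auto
  then show ?thesis by (simp add: satisfies_def phase_def mult_ac)
qed

text \<open>Dividing \<open>y\<close> by the scale gives a solution of the scaled rows, and the
  scale cancels because the objective is homogeneous.\<close>

lemma phase_cost:
  assumes y: "feasible n As y"
  shows "objf F (phase n F K As) \<le> 180 * (1 + 2 * ln K) * objf F y"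
proof -
  let ?s = "row_scale n K As"
  let ?bs = "map (\<lambda>a j. ?s * a j) As"
  let ?run = "norm_cover.run (active F) (coef F) (supp F) (expo F) n (K\<^sup>2) ?bs"
  let ?y = "\<lambda>j. (1 / ?s) * y j"
  have "norm_cover.cost (active F) (coef F) (supp F) (expo F) ?run
      \<le> 180 * (1 + ln (K\<^sup>2)) * norm_cover.cost (active F) (coef F) (supp F) (expo F) ?y"
  proof (rule norm_covering.run_cost[OF norm_covering scaled_rows_valid])
    fix b assume "b \<in> set ?bs"
    then obtain a where a: "a \<in> set As" "b = (\<lambda>j. ?s * a j)" by auto
    show "norm_cover.bounded_row n (K\<^sup>2) b" using scaled_row_bounded[OF a(1)] a(2) by simp
    have "satisfies n a y" using y a(1) by (simp add: feasible_def)
    then show "satisfies n b ?y" using row_scale_pos by (simp add: a(2) satisfies_def)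
  next
    fix j assume "j < n"
    then show "0 \<le> ?y j" using y row_scale_pos by (simp add: feasible_def)
  qed
  then have "objf F ?run \<le> 180 * (1 + ln (K\<^sup>2)) * objf F ?y" by (simp only: objf_eq_cost[OF F])
  also have "objf F ?y = 1 / ?s * objf F y" using row_scale_pos by (intro objf_scale[OF F]) auto
  also have "ln (K\<^sup>2) = 2 * ln K" using guess_ge_1 by (simp add: ln_realpow)
  finally have "?s * objf F ?run \<le> ?s * (180 * (1 + 2 * ln K) * (1 / ?s * objf F y))"
    using row_scale_pos by (intro mult_left_mono) auto
  moreover have "objf F (phase n F K As) = ?s * objf F ?run"
    unfolding phase_def using row_scale_pos by (intro objf_scale[OF F]) auto
  ultimately show ?thesis using row_scale_pos by simp
qed

end

text \<open>The scale depends on the first row alone, so for a fixed guess the longer run extends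
  the shorter one.\<close>

lemma phase_snoc_ge:
  assumes F: "valid_obj n F" and As: "valid_rows n (As @ [a])"
    and K: "kappa n (As @ [a]) * real (dpar n F (As @ [a])) \<le> K" and j: "j < n"
  shows "phase n F K As j \<le> phase n F K (As @ [a]) j"
proof (cases "As = []")
  case True
  then show ?thesis using phase_nonneg[OF F As _ K j] by (simp add: phase_Nil)
next
  case False
  have s: "row_scale n K (As @ [a]) = row_scale n K As" using False by (simp add: row_scale_def)
  have "norm_cover.run (active F) (coef F) (supp F) (expo F) n (K\<^sup>2) (map (\<lambda>a j. row_scale n K As * a j) As) j
    \<le> norm_cover.run (active F) (coef F) (supp F) (expo F) n (K\<^sup>2)
        (map (\<lambda>a j. row_scale n K As * a j) As @ [\<lambda>j. row_scale n K As * a j]) j"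
    using scaled_rows_valid[OF F As _ K] s j
    by (intro norm_covering.run_ge[OF norm_covering[OF F As _ K]]) auto
  then show ?thesis
    using row_scale_pos[OF F As _ K] by (simp add: phase_def s)
qed

text \<open>The guesses grow doubly exponentially, so the competitive ratios of successive guesses grow
  geometrically and the last one dominates.\<close>

definition level :: "nat \<Rightarrow> objective \<Rightarrow> vec list \<Rightarrow> nat" where
  "level n F As = (if As = [] then 0 else (LEAST k. kappa n As * real (dpar n F As) \<le> exp (2 ^ k)))"

lemma prod_le_exp_level:
  assumes "As \<noteq> []"
  shows "kappa n As * real (dpar n F As) \<le> exp (2 ^ level n F As)"
proof -
  obtain k where "kappa n As * real (dpar n F As) < 2 ^ k"
    using real_arch_pow[of 2] by auto
  also have "(2::real) ^ k \<le> exp (2 ^ k)" using exp_ge_add_one_self[of "2 ^ k"] by linarith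
  finally have "\<exists>k. kappa n As * real (dpar n F As) \<le> exp (2 ^ k)" by (auto intro: less_imp_le)
  from LeastI_ex[OF this] show ?thesis using assms by (simp add: level_def)
qed

lemma level_snoc_ge:
  assumes "valid_obj n F" "valid_rows n (As @ [a])"
  shows "level n F As \<le> level n F (As @ [a])"
proof (cases "As = []")
  case False
  have "kappa n As * real (dpar n F As) \<le> exp (2 ^ level n F (As @ [a]))"
    using prod_snoc_le[of n F As a] prod_le_exp_level[of "As @ [a]" n F] assms False
    by (auto simp: valid_rows_snoc)
  then have "(LEAST k. kappa n As * real (dpar n F As) \<le> exp (2 ^ k)) \<le> level n F (As @ [a])"
    by (rule Least_le)
  then show ?thesis using False by (simp add: level_def)
qed (simp add: level_def)

text \<open>By minimality the guess one level below fails, so half of the left side is less than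
  \<open>ln\<close> of \<kappa> d. The summand 1 covers level 0.\<close>

lemma two_power_level_le:
  assumes "valid_obj n F" "valid_rows n As" "As \<noteq> []"
  shows "2 ^ level n F As \<le> 2 * (1 + ln (kappa n As * real (dpar n F As)))"
proof (cases "level n F As")
  case 0
  then show ?thesis using prod_ge_1[OF assms] by simp
next
  case (Suc k)
  then have "\<not> kappa n As * real (dpar n F As) \<le> exp (2 ^ k)"
    using not_less_Least[of k "\<lambda>k. kappa n As * real (dpar n F As) \<le> exp (2 ^ k)"] assms(3)
    by (simp add: level_def)
  then have "ln (exp (2 ^ k)) < ln (kappa n As * real (dpar n F As))"
    using prod_ge_1[OF assms] by (subst ln_less_cancel_iff) auto
  then show ?thesis using Suc by simp
qed

section \<open>Joining the successive guesses\<close>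

primrec unadvised_rev :: "nat \<Rightarrow> objective \<Rightarrow> vec list \<Rightarrow> vec" where
  "unadvised_rev n F [] = (\<lambda>_. 0)"
| "unadvised_rev n F (a # rs) = (\<lambda>j. max (unadvised_rev n F rs j)
     (phase n F (exp (2 ^ level n F (rev (a # rs)))) (rev (a # rs)) j))"

text \<open>The recursion is over the reversed list, so that the newest row is the head and each
  tail is an earlier prefix; the running maximum makes the output monotone.\<close>

definition unadvised :: "nat \<Rightarrow> objective \<Rightarrow> vec list \<Rightarrow> vec" where
  "unadvised n F As = unadvised_rev n F (rev As)"

lemma unadvised_Nil: "unadvised n F [] = (\<lambda>_. 0)"
  by (simp add: unadvised_def)

lemma unadvised_snoc:
  "unadvised n F (As @ [a]) =
     (\<lambda>j. max (unadvised n F As j) (phase n F (exp (2 ^ level n F (As @ [a]))) (As @ [a]) j))"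
  by (simp add: unadvised_def)

lemma unadvised_nonneg: "0 \<le> unadvised n F As j"
  by (induction As rule: rev_induct) (simp_all add: unadvised_Nil unadvised_snoc le_max_iff_disj)

lemma unadvised_feasible:
  assumes F: "valid_obj n F" and As: "valid_rows n As"
  shows "feasible n As (unadvised n F As)"
proof (cases As rule: rev_exhaust)
  case Nil
  then show ?thesis by (simp add: feasible_def unadvised_Nil)
next
  case (snoc Bs b)
  have "satisfies n a (unadvised n F As)" if a: "a \<in> set As" for a
  proof -
    have "satisfies n a (phase n F (exp (2 ^ level n F As)) As)"
      using snoc a by (intro phase_satisfies F As prod_le_exp_level) auto
    moreover have "valid_row n a" using As a by (simp add: valid_rows_def)
    ultimately show ?thesis unfolding snoc unadvised_snoc by (intro satisfies_max) auto
  qed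
  then show ?thesis by (simp add: feasible_def unadvised_nonneg)
qed

lemma phase_level_cost:
  assumes F: "valid_obj n F" and As: "valid_rows n As" and y: "feasible n As y"
  shows "objf F (phase n F (exp (2 ^ level n F As)) As) \<le> 540 * 2 ^ level n F As * objf F y"
proof (cases "As = []")
  case True
  then show ?thesis using objf_nonneg[OF F] by (simp add: phase_Nil)
next
  case False
  have "objf F (phase n F (exp (2 ^ level n F As)) As)
      \<le> 180 * (1 + 2 * ln (exp (2 ^ level n F As))) * objf F y"
    by (intro phase_cost F As False prod_le_exp_level y)
  also have "\<dots> \<le> 540 * 2 ^ level n F As * objf F y"
    using objf_nonneg[OF F] one_le_power[of "2::real" "level n F As"] by (intro mult_right_mono) auto
  finally show ?thesis .
qed

text \<open>Here \<open>u\<close> joins the final solutions of the finished guesses; the current one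
  stays apart because it still grows. When the level k rises, the old phase moves into
  \<open>u\<close>, and \<open>2 ^ k + 2 ^ k = 2 ^ Suc k\<close> preserves the bound.\<close>

lemma unadvised_decompose:
  assumes F: "valid_obj n F" and As: "valid_rows n As" and y: "feasible n As y"
  shows "\<exists>u. (\<forall>j<n. 0 \<le> u j \<and> unadvised n F As j \<le> max (u j) (phase n F (exp (2 ^ level n F As)) As j))
    \<and> objf F u \<le> 540 * 2 ^ level n F As * objf F y"
  using As y
proof (induction As rule: rev_induct)
  case Nil
  then show ?case
    using objf_nonneg[OF F] by (intro exI[of _ "\<lambda>_. 0"]) (simp add: unadvised_Nil)
next
  case (snoc a As)
  then have As: "valid_rows n As" "feasible n As y" by (auto simp: valid_rows_snoc feasible_def)
  let ?k = "level n F As" and ?k' = "level n F (As @ [a])"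
  let ?p = "\<lambda>k. phase n F (exp (2 ^ k))"
  obtain u where u: "\<And>j. j < n \<Longrightarrow> 0 \<le> u j"
      "\<And>j. j < n \<Longrightarrow> unadvised n F As j \<le> max (u j) (?p ?k As j)"
      "objf F u \<le> 540 * 2 ^ ?k * objf F y"
    using snoc.IH[OF As] by blast
  show ?case
  proof (cases "?k = ?k'")
    case True
    have "?p ?k As j \<le> ?p ?k' (As @ [a]) j" if "j < n" for j
      unfolding True using snoc.prems that by (intro phase_snoc_ge[OF F] prod_le_exp_level) auto
    then show ?thesis
      using u True by (intro exI[of _ u]) (fastforce simp: unadvised_snoc le_max_iff_disj)
  next
    case False
    then have k: "Suc ?k \<le> ?k'" using level_snoc_ge[OF F snoc.prems(1)] by simp
    have p: "0 \<le> ?p ?k As j" if "j < n" for j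
      using phase_nonneg[OF F As(1) _ prod_le_exp_level that] by (cases "As = []") (auto simp: phase_Nil)
    let ?u = "\<lambda>j. max (u j) (?p ?k As j)"
    have "objf F ?u \<le> objf F u + objf F (?p ?k As)" using u(1) p by (intro objf_max_le[OF F])
    also have "\<dots> \<le> 540 * 2 ^ Suc ?k * objf F y"
      using u(3) phase_level_cost[OF F As] by simp
    also have "\<dots> \<le> 540 * 2 ^ ?k' * objf F y"
      using k objf_nonneg[OF F] by (intro mult_right_mono mult_left_mono power_increasing) auto
    finally show ?thesis
      using u p by (intro exI[of _ ?u]) (fastforce simp: unadvised_snoc le_max_iff_disj)
  qed
qed

text \<open>The finished guesses and the current one each contribute a factor
  \<open>540 * 2 ^ level n F As\<close>; \<open>two_power_level_le\<close> doubles their sum to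
  2160.\<close>

lemma unadvised_cost:
  assumes F: "valid_obj n F" and As: "valid_rows n As" "As \<noteq> []" and y: "feasible n As y"
  shows "objf F (unadvised n F As) \<le> 2160 * (1 + ln (kappa n As * real (dpar n F As))) * objf F y"
proof -
  let ?p = "phase n F (exp (2 ^ level n F As)) As"
  obtain u where u: "\<And>j. j < n \<Longrightarrow> 0 \<le> u j"
      "\<And>j. j < n \<Longrightarrow> unadvised n F As j \<le> max (u j) (?p j)"
      "objf F u \<le> 540 * 2 ^ level n F As * objf F y"
    using unadvised_decompose[OF F As(1) y] by blast
  have p: "0 \<le> ?p j" if "j < n" for j
    by (rule phase_nonneg[OF F As prod_le_exp_level[OF As(2)] that])
  have "objf F (unadvised n F As) \<le> objf F (\<lambda>j. max (u j) (?p j))"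
    using u unadvised_nonneg by (intro objf_mono[OF F]) auto
  also have "\<dots> \<le> objf F u + objf F ?p" using u(1) p by (intro objf_max_le[OF F])
  also have "\<dots> \<le> 1080 * 2 ^ level n F As * objf F y"
    using u(3) phase_level_cost[OF F As(1) y] by simp
  also have "\<dots> \<le> 2160 * (1 + ln (kappa n As * real (dpar n F As))) * objf F y"
    using two_power_level_le[OF F As] objf_nonneg[OF F] by (intro mult_right_mono) auto
  finally show ?thesis .
qed

section \<open>Comparison with the optimum\<close>

lemma OPT_nonneg:
  assumes F: "valid_obj n F" and As: "valid_rows n As"
  shows "0 \<le> OPT n F As"
  unfolding OPT_def using unadvised_feasible[OF F As] objf_nonneg[OF F]
  by (intro cInf_greatest) auto

lemma unadvised_competitive:
  assumes F: "valid_obj n F" and As: "valid_rows n As" "As \<noteq> []"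
  shows "objf F (unadvised n F As) \<le> 2160 * (1 + ln (kappa n As * real (dpar n F As))) * OPT n F As"
proof -
  let ?R = "2160 * (1 + ln (kappa n As * real (dpar n F As)))"
  have R: "0 < ?R" using ln_ge_zero[OF prod_ge_1[OF F As]] by (simp add: add_pos_nonneg)
  \<comment> \<open>The optimum is an infimum, so the positive ratio is divided out before the
    bounds for all feasible \<open>y\<close> are combined.\<close>
  have "objf F (unadvised n F As) / ?R \<le> OPT n F As"
    unfolding OPT_def
  proof (rule cInf_greatest)
    show "objf F ` {x. feasible n As x} \<noteq> {}" using unadvised_feasible[OF F As(1)] by blast
    fix v assume "v \<in> objf F ` {x. feasible n As x}"
    then obtain y where y: "feasible n As y" "v = objf F y" by blast
    show "objf F (unadvised n F As) / ?R \<le> v"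
      using unadvised_cost[OF F As y(1)] R by (subst pos_divide_le_eq) (auto simp: y(2) mult.commute)
  qed
  then show ?thesis using R by (simp only: pos_divide_le_eq mult.commute)
qed

text \<open>Settles the empty instance, where \<open>kappa\<close> is a quotient of extrema over the
  empty set and has no useful value.\<close>

lemma OPT_Nil:
  assumes F: "valid_obj n F"
  shows "OPT n F [] = 0"
  unfolding OPT_def
proof (rule cInf_eq_minimum)
  have "(\<lambda>_. 0) \<in> {x. feasible n [] x}" by (simp add: feasible_def)
  from imageI[OF this, of "objf F"] show "0 \<in> objf F ` {x. feasible n [] x}" by simp
qed (use objf_nonneg[OF F] in auto)

section \<open>Following the advice\<close>

text \<open>The unadvised cost only grows and \<open>x'\<close> can only lose feasibility as rows
  arrive, so a branch once left is never entered again.\<close>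

definition proposal :: "nat \<Rightarrow> objective \<Rightarrow> vec \<Rightarrow> vec list \<Rightarrow> vec" where
  "proposal n F x' As =
     (if objf F (unadvised n F As) \<le> objf F x' then unadvised n F As
      else if \<forall>a\<in>set As. satisfies n a x' then x'
      else (\<lambda>j. max (x' j) (unadvised n F As j)))"

primrec advised_rev :: "nat \<Rightarrow> objective \<Rightarrow> vec \<Rightarrow> vec list \<Rightarrow> vec" where
  "advised_rev n F x' [] = (\<lambda>_. 0)"
| "advised_rev n F x' (a # rs) = (\<lambda>j. max (advised_rev n F x' rs j) (proposal n F x' (rev (a # rs)) j))"

definition advised :: "nat \<Rightarrow> objective \<Rightarrow> vec \<Rightarrow> vec list \<Rightarrow> vec" where
  "advised n F x' As = advised_rev n F x' (rev As)"

lemma advised_Nil: "advised n F x' [] = (\<lambda>_. 0)"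
  by (simp add: advised_def)

lemma advised_snoc:
  "advised n F x' (As @ [a]) = (\<lambda>j. max (advised n F x' As j) (proposal n F x' (As @ [a]) j))"
  by (simp add: advised_def)

lemma advised_nonneg: "0 \<le> advised n F x' As j"
  by (induction As rule: rev_induct) (simp_all add: advised_Nil advised_snoc le_max_iff_disj)

lemma unadvised_snoc_ge: "unadvised n F As j \<le> unadvised n F (As @ [a]) j"
  by (simp add: unadvised_snoc)

lemma advised_feasible:
  assumes F: "valid_obj n F" and As: "valid_rows n As"
  shows "feasible n As (advised n F x' As)"
proof (cases As rule: rev_exhaust)
  case Nil
  then show ?thesis by (simp add: feasible_def advised_Nil)
next
  case (snoc Bs b)
  have "satisfies n a (advised n F x' As)" if a: "a \<in> set As" for a
  proof -
    have v: "valid_row n a" using As a by (simp add: valid_rows_def)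
    have "satisfies n a (unadvised n F As)"
      using unadvised_feasible[OF F As] a by (simp add: feasible_def)
    then have "satisfies n a (proposal n F x' As)"
      using a by (auto simp: proposal_def intro: satisfies_max[OF v])
    then show ?thesis unfolding snoc advised_snoc using snoc by (intro satisfies_max[OF v]) auto
  qed
  then show ?thesis by (simp add: feasible_def advised_nonneg)
qed

text \<open>If the unadvised solution is cheap now, it was cheap at every earlier row, so nothing
  else was ever proposed. In general each proposal lies below the maximum of \<open>x'\<close> and
  the current unadvised solution.\<close>

lemma advised_le:
  assumes F: "valid_obj n F"
  shows advised_le_cheap: "objf F (unadvised n F As) \<le> objf F x' \<Longrightarrow> j < n \<Longrightarrow>
      advised n F x' As j \<le> unadvised n F As j"
    and advised_le_max: "j < n \<Longrightarrow> advised n F x' As j \<le> max (x' j) (unadvised n F As j)"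
proof (induction As arbitrary: j rule: rev_induct)
  case Nil
  {
    case 1
    then show ?case by (simp add: advised_Nil unadvised_Nil)
  next
    case 2
    then show ?case by (simp add: advised_Nil unadvised_Nil)
  }
next
  case (snoc a As)
  {
    case 1
    have "objf F (unadvised n F As) \<le> objf F (unadvised n F (As @ [a]))"
      using unadvised_nonneg unadvised_snoc_ge by (intro objf_mono[OF F]) auto
    then have "advised n F x' As j \<le> unadvised n F As j" using 1 snoc.IH(1) by simp
    then show ?case
      using 1 unadvised_snoc_ge[of n F As j a] by (simp add: advised_snoc proposal_def)
  next
    case 2
    then have "advised n F x' As j \<le> max (x' j) (unadvised n F As j)" by (rule snoc.IH(2))
    moreover have "proposal n F x' (As @ [a]) j \<le> max (x' j) (unadvised n F (As @ [a]) j)"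
      by (simp add: proposal_def)
    ultimately show ?case
      using unadvised_snoc_ge[of n F As j a] by (simp add: advised_snoc le_max_iff_disj) linarith
  }
qed

text \<open>Here \<open>w\<close> is the last unadvised solution that costs no more than
  \<open>x'\<close>, or 0 if there is none; every later proposal is \<open>x'\<close>
  itself.\<close>

lemma advised_le_consistent:
  assumes F: "valid_obj n F" and x': "\<And>j. j < n \<Longrightarrow> 0 \<le> x' j" and sat: "\<forall>a\<in>set As. satisfies n a x'"
  shows "\<exists>w. (\<forall>j<n. 0 \<le> w j \<and> advised n F x' As j \<le> max (x' j) (w j)) \<and> objf F w \<le> objf F x'"
  using sat
proof (induction As rule: rev_induct)
  case Nil
  then show ?case
    using x' objf_nonneg[OF F] by (intro exI[of _ "\<lambda>_. 0"]) (simp add: advised_Nil)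
next
  case (snoc a As)
  show ?case
  proof (cases "objf F (unadvised n F (As @ [a])) \<le> objf F x'")
    case True
    then show ?thesis
      using advised_le_max[OF F] unadvised_nonneg by (intro exI[of _ "unadvised n F (As @ [a])"]) auto
  next
    case False
    then have "proposal n F x' (As @ [a]) = x'" using snoc.prems by (simp add: proposal_def)
    then show ?thesis using snoc by (auto simp: advised_snoc)
  qed
qed

lemma advised_cost_consistent:
  assumes F: "valid_obj n F" and x': "\<And>j. j < n \<Longrightarrow> 0 \<le> x' j" and sat: "\<forall>a\<in>set As. satisfies n a x'"
  shows "objf F (advised n F x' As) \<le> 2 * objf F x'"
proof -
  obtain w where w: "\<And>j. j < n \<Longrightarrow> 0 \<le> w j" "\<And>j. j < n \<Longrightarrow> advised n F x' As j \<le> max (x' j) (w j)"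
      "objf F w \<le> objf F x'"
    using advised_le_consistent[OF F x' sat] by blast
  have "objf F (advised n F x' As) \<le> objf F (\<lambda>j. max (x' j) (w j))"
    using w advised_nonneg by (intro objf_mono[OF F]) auto
  also have "\<dots> \<le> objf F x' + objf F w" using x' w by (intro objf_max_le[OF F])
  finally show ?thesis using w(3) by simp
qed

text \<open>Either only unadvised solutions were proposed, or \<open>x'\<close> is cheaper than the
  unadvised solution and their maximum costs at most twice the latter.\<close>

lemma advised_cost_robust:
  assumes F: "valid_obj n F" and x': "\<And>j. j < n \<Longrightarrow> 0 \<le> x' j"
  shows "objf F (advised n F x' As) \<le> 2 * objf F (unadvised n F As)"
proof (cases "objf F (unadvised n F As) \<le> objf F x'")
  case True
  then have "objf F (advised n F x' As) \<le> objf F (unadvised n F As)"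
    using advised_le_cheap[OF F] advised_nonneg by (intro objf_mono[OF F]) auto
  then show ?thesis using objf_nonneg[OF F, of "unadvised n F As"] by linarith
next
  case False
  have "objf F (advised n F x' As) \<le> objf F (\<lambda>j. max (x' j) (unadvised n F As j))"
    using advised_le_max[OF F] advised_nonneg by (intro objf_mono[OF F]) auto
  also have "\<dots> \<le> objf F x' + objf F (unadvised n F As)"
    using x' unadvised_nonneg by (intro objf_max_le[OF F])
  finally show ?thesis using False by simp
qed

text \<open>Both entries of the minimum dominate the bound \<open>robust\<close>: the first adds a
  nonnegative term, the second divides by \<open>lam < 1\<close> inside the logarithm. The constant
  is twice that of \<open>unadvised_competitive\<close>.\<close>

lemma advised_cost_min:
  assumes F: "valid_obj n F" and x': "\<And>j. j < n \<Longrightarrow> 0 \<le> x' j" and lam: "0 < lam" "lam < 1"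
    and As: "valid_rows n As"
  shows "objf F (advised n F x' As) \<le>
    min (4320 / (1 - lam) * objf F x'
           + 4320 * (1 + ln (kappa n As * real (dpar n F As))) * OPT n F As)
        (4320 * (1 + ln (kappa n As * real (dpar n F As) / lam)) * OPT n F As)"
proof (cases "As = []")
  case True
  then show ?thesis
    using objf_nonneg[OF F] lam by (simp add: advised_Nil OPT_Nil[OF F])
next
  case False
  let ?p = "kappa n As * real (dpar n F As)"
  have p: "1 \<le> ?p" by (rule prod_ge_1[OF F As False])
  have "objf F (advised n F x' As) \<le> 2 * objf F (unadvised n F As)"
    using x' by (intro advised_cost_robust[OF F])
  also have "\<dots> \<le> 2 * (2160 * (1 + ln ?p) * OPT n F As)"
    using unadvised_competitive[OF F As False] by (rule mult_left_mono) simp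
  finally have robust: "objf F (advised n F x' As) \<le> 4320 * (1 + ln ?p) * OPT n F As"
    by (simp add: algebra_simps)
  have nonneg: "0 \<le> 4320 / (1 - lam) * objf F x'" using lam objf_nonneg[OF F] by simp
  have "4320 * (1 + ln ?p) * OPT n F As \<le> 4320 * (1 + ln (?p / lam)) * OPT n F As"
  proof -
    have "?p * lam \<le> ?p * 1" using p lam by (intro mult_left_mono) auto
    then have "?p \<le> ?p / lam" using lam by (simp add: pos_le_divide_eq)
    then have "ln ?p \<le> ln (?p / lam)" using p by (intro ln_mono) auto
    then show ?thesis using OPT_nonneg[OF F As] by (intro mult_right_mono) auto
  qed
  with robust show ?thesis
    using add_increasing[OF nonneg robust] by (intro min.boundedI) (auto intro: order_trans)
qed

theorem mainTheorem5:
  shows "\<exists>(alg :: online_alg) (C :: real). C > 0 \<and>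
    (\<forall>n F x' lam. valid_obj n F \<and> (\<forall>j<n. x' j \<ge> 0) \<and> 0 < lam \<and> lam < 1 \<longrightarrow>
      (\<forall>As a. valid_rows n (As @ [a]) \<longrightarrow>
          (\<forall>j<n. alg n F x' lam As j \<le> alg n F x' lam (As @ [a]) j)) \<and>
      (\<forall>As. valid_rows n As \<longrightarrow>
          feasible n As (alg n F x' lam As) \<and>
          objf F (alg n F x' lam As) \<le>
            min (C / (1 - lam) * objf F x'
                   + C * (1 + ln (kappa n As * real (dpar n F As))) * OPT n F As)
                (C * (1 + ln (kappa n As * real (dpar n F As) / lam)) * OPT n F As) \<and>
          ((\<forall>a\<in>set As. satisfies n a x') \<longrightarrow>
             objf F (alg n F x' lam As) \<le> C / (1 - lam) * objf F x')))"
proof (intro exI[of _ "\<lambda>n F x' lam As. advised n F x' As"] exI[of _ 4320] conjI allI impI; (elim conjE)?)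
  fix n F and x' :: vec and lam :: real and As :: "vec list"
  assume F: "valid_obj n F" and x': "\<forall>j<n. 0 \<le> x' j" and lam: "0 < lam" "lam < 1"
    and As: "valid_rows n As"
  show "feasible n As (advised n F x' As)" by (rule advised_feasible[OF F As])
  show "objf F (advised n F x' As) \<le>
            min (4320 / (1 - lam) * objf F x'
                   + 4320 * (1 + ln (kappa n As * real (dpar n F As))) * OPT n F As)
                (4320 * (1 + ln (kappa n As * real (dpar n F As) / lam)) * OPT n F As)"
    using x' by (intro advised_cost_min[OF F _ lam As]) auto
  assume sat: "\<forall>a\<in>set As. satisfies n a x'"
  have "objf F (advised n F x' As) \<le> 2 * objf F x'"
    using x' by (intro advised_cost_consistent[OF F _ sat]) auto
  \<comment> \<open>Since \<open>0 < 1 - lam\<close> and \<open>1 - lam < 1\<close>, the factor 2 is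
    covered.\<close>
  also have "\<dots> \<le> 4320 / (1 - lam) * objf F x'"
    using lam objf_nonneg[OF F] by (intro mult_right_mono) (auto simp: field_simps)
  finally show "objf F (advised n F x' As) \<le> 4320 / (1 - lam) * objf F x'" .
\<comment> \<open>What remains is positivity of the constant and monotonicity, which holds because
  \<open>advised\<close> is a running maximum.\<close>
qed (simp_all add: advised_snoc)

end
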